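(* The following is provable in ZF (without the Axiom of Choice): $CAC_1^{\aleph_0}$ implies $PAC_{fin}^{\aleph_1}$.
   Context: In a partially ordered set, a chain is a linearly ordered subset and an antichain is a subset no two distinct elements of which are comparable. Countable means of size at most $\aleph_0$. $CAC_1^{\aleph_0}$: if in a partially ordered set all antichains are finite and all chains are countable, then the set is countable. $PAC_{fin}^{\aleph_1}$: every $\aleph_1$-sized family $\mathcal{A}$ of non-empty finite sets has an $\aleph_1$-sized subfamily $\mathcal{B}$ with a choice function. *)

theory Defs
  imports Main
begin

text \<open>
  Provability in ZF has to be a statement about a deep embedding: HOL itself has a choice operator,
  so a direct rendering of both principles in HOL would make each of them a theorem.  We therefore
  formalize first-order logic over the language of set theory, the ZF axioms and derivability.
\<close>


section \<open>First-order logic over the language of set theory\<close>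

text \<open>
  Variables are de Bruijn indices: \<open>Forall p\<close> binds index 0 in \<open>p\<close>.  There are no function symbols,
  so the only terms are variables and substitution of terms is renaming of variables.
\<close>

datatype fm =
    Member nat nat  (infix \<open>\<^bold>\<in>\<close> 60)
  | Equal nat nat  (infix \<open>\<^bold>=\<close> 60)
  | Falsum
  | Imp fm fm  (infixr \<open>\<^bold>\<longrightarrow>\<close> 50)
  | Forall fm

definition Not_fm :: "fm \<Rightarrow> fm"  (\<open>\<^bold>\<not> _\<close> [59] 59)
  where "\<^bold>\<not> p = (p \<^bold>\<longrightarrow> Falsum)"

definition Or_fm :: "fm \<Rightarrow> fm \<Rightarrow> fm"  (infixr \<open>\<^bold>\<or>\<close> 53)
  where "p \<^bold>\<or> q = (\<^bold>\<not> p \<^bold>\<longrightarrow> q)"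

definition And_fm :: "fm \<Rightarrow> fm \<Rightarrow> fm"  (infixr \<open>\<^bold>\<and>\<close> 55)
  where "p \<^bold>\<and> q = (\<^bold>\<not> (p \<^bold>\<longrightarrow> \<^bold>\<not> q))"

definition Iff_fm :: "fm \<Rightarrow> fm \<Rightarrow> fm"  (infix \<open>\<^bold>\<longleftrightarrow>\<close> 49)
  where "(p \<^bold>\<longleftrightarrow> q) = ((p \<^bold>\<longrightarrow> q) \<^bold>\<and> (q \<^bold>\<longrightarrow> p))"

definition Exists :: "fm \<Rightarrow> fm"
  where "Exists p = (\<^bold>\<not> Forall (\<^bold>\<not> p))"

text \<open>
  Bounded quantifiers: \<open>x\<close> is an index in the context outside the quantifier, while inside \<open>p\<close>
  index 0 is the bound variable and all outer indices are shifted by one.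
\<close>

definition All_in :: "nat \<Rightarrow> fm \<Rightarrow> fm"
  where "All_in x p = Forall (0 \<^bold>\<in> x + 1 \<^bold>\<longrightarrow> p)"

definition Ex_in :: "nat \<Rightarrow> fm \<Rightarrow> fm"
  where "Ex_in x p = Exists (0 \<^bold>\<in> x + 1 \<^bold>\<and> p)"

primrec rename :: "(nat \<Rightarrow> nat) \<Rightarrow> fm \<Rightarrow> fm" where
  "rename f (x \<^bold>\<in> y) = (f x \<^bold>\<in> f y)"
| "rename f (x \<^bold>= y) = (f x \<^bold>= f y)"
| "rename f Falsum = Falsum"
| "rename f (p \<^bold>\<longrightarrow> q) = (rename f p \<^bold>\<longrightarrow> rename f q)"
| "rename f (Forall p) = Forall (rename (case_nat 0 (\<lambda>n. Suc (f n))) p)"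

text \<open>\<open>inst x p\<close> instantiates index 0 of \<open>p\<close> with the variable \<open>x\<close> and lowers the other indices.\<close>

definition inst :: "nat \<Rightarrow> fm \<Rightarrow> fm"
  where "inst x = rename (case_nat x (\<lambda>n. n))"

text \<open>All free indices of \<open>p\<close> are below \<open>arity p\<close>.\<close>

primrec arity :: "fm \<Rightarrow> nat" where
  "arity (x \<^bold>\<in> y) = Suc (max x y)"
| "arity (x \<^bold>= y) = Suc (max x y)"
| "arity Falsum = 0"
| "arity (p \<^bold>\<longrightarrow> q) = max (arity p) (arity q)"
| "arity (Forall p) = arity p - 1"

definition univ_closure :: "fm \<Rightarrow> fm"
  where "univ_closure p = (Forall ^^ arity p) p"

text \<open>
  Classical natural deduction with equality.  The eigenvariable condition of the rule \<open>ForallI\<close> is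
  expressed by shifting the assumptions, which makes index 0 fresh for them.  The set of
  assumptions may be infinite, but a derivation uses only finitely many of them.
\<close>

inductive derives :: "fm set \<Rightarrow> fm \<Rightarrow> bool"  (infix \<open>\<turnstile>\<close> 45) where
  Assm: "p \<in> H \<Longrightarrow> H \<turnstile> p"
| ImpI: "insert p H \<turnstile> q \<Longrightarrow> H \<turnstile> (p \<^bold>\<longrightarrow> q)"
| ImpE: "H \<turnstile> (p \<^bold>\<longrightarrow> q) \<Longrightarrow> H \<turnstile> p \<Longrightarrow> H \<turnstile> q"
| Contr: "insert (\<^bold>\<not> p) H \<turnstile> Falsum \<Longrightarrow> H \<turnstile> p"
| ForallI: "rename Suc ` H \<turnstile> p \<Longrightarrow> H \<turnstile> Forall p"
| ForallE: "H \<turnstile> Forall p \<Longrightarrow> H \<turnstile> inst x p"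
| EqRefl: "H \<turnstile> (x \<^bold>= x)"
| EqSubst: "H \<turnstile> (x \<^bold>= y) \<Longrightarrow> H \<turnstile> inst x p \<Longrightarrow> H \<turnstile> inst y p"


section \<open>The axioms of ZF\<close>

text \<open>
  In this section and the next, defined notions take indices of variables as arguments, and
  bracketed lists in comments give the innermost bound variables, index 0 first.
\<close>

definition is_empty :: "nat \<Rightarrow> fm"
  where "is_empty x = Forall (\<^bold>\<not> 0 \<^bold>\<in> x + 1)"

definition is_subset :: "nat \<Rightarrow> nat \<Rightarrow> fm"
  where "is_subset x y = All_in x (0 \<^bold>\<in> y + 1)"

text \<open>\<open>y = x \<union> {x}\<close>\<close>

definition is_succ :: "nat \<Rightarrow> nat \<Rightarrow> fm"
  where "is_succ x y = Forall (0 \<^bold>\<in> y + 1 \<^bold>\<longleftrightarrow> (0 \<^bold>\<in> x + 1 \<^bold>\<or> 0 \<^bold>= x + 1))"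

definition is_inductive :: "nat \<Rightarrow> fm"
  where "is_inductive x =
    (Ex_in x (is_empty 0) \<^bold>\<and> All_in x (Ex_in (x + 1) (is_succ 1 0)))"

definition extensionality_ax :: fm
  where "extensionality_ax =
    Forall (Forall (Forall (0 \<^bold>\<in> 2 \<^bold>\<longleftrightarrow> 0 \<^bold>\<in> 1) \<^bold>\<longrightarrow> 1 \<^bold>= 0))"

definition foundation_ax :: fm
  where "foundation_ax =
    Forall (\<^bold>\<not> is_empty 0 \<^bold>\<longrightarrow> Ex_in 0 (\<^bold>\<not> Ex_in 0 (0 \<^bold>\<in> 2)))"

definition pairing_ax :: fm
  where "pairing_ax =
    Forall (Forall (Exists (Forall (0 \<^bold>\<in> 1 \<^bold>\<longleftrightarrow> (0 \<^bold>= 3 \<^bold>\<or> 0 \<^bold>= 2)))))"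

definition union_ax :: fm
  where "union_ax = Forall (Exists (Forall (0 \<^bold>\<in> 1 \<^bold>\<longleftrightarrow> Ex_in 2 (1 \<^bold>\<in> 0))))"

definition power_set_ax :: fm
  where "power_set_ax = Forall (Exists (Forall (0 \<^bold>\<in> 1 \<^bold>\<longleftrightarrow> is_subset 0 2)))"

definition infinity_ax :: fm
  where "infinity_ax = Exists (is_inductive 0)"

text \<open>
  \<open>\<exists>b. \<forall>x. x \<in> b \<longleftrightarrow> x \<in> a \<and> p\<close>, where \<open>p\<close> is read in the context \<open>[x, a, parameters]\<close>.  The
  renaming moves \<open>p\<close> to the context \<open>[x, b, a, parameters]\<close>, so \<open>b\<close> does not occur in it.
\<close>

definition separation_ax :: "fm \<Rightarrow> fm"
  where "separation_ax p = univ_closure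
    (Exists (Forall (0 \<^bold>\<in> 1 \<^bold>\<longleftrightarrow> (0 \<^bold>\<in> 2 \<^bold>\<and> rename (case_nat 0 (\<lambda>n. n + 2)) p))))"

text \<open>
  If \<open>p\<close>, read in the context \<open>[y, x, a, parameters]\<close>, determines at most one \<open>y\<close> for each
  \<open>x \<in> a\<close>, then \<open>\<exists>b. \<forall>y. y \<in> b \<longleftrightarrow> (\<exists>x\<in>a. p)\<close>.  The renamings move \<open>p\<close> to the contexts
  \<open>[z, y, x, a, parameters]\<close> (once for \<open>(x, y)\<close>, once for \<open>(x, z)\<close>) and
  \<open>[x, y, b, a, parameters]\<close>.
\<close>

definition replacement_ax :: "fm \<Rightarrow> fm"
  where "replacement_ax p = univ_closure
    (All_in 0 (Forall (Forall
        (rename Suc p \<^bold>\<and> rename (case_nat 0 (\<lambda>n. n + 2)) p \<^bold>\<longrightarrow> 1 \<^bold>= 0))) \<^bold>\<longrightarrow>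
     Exists (Forall (0 \<^bold>\<in> 1 \<^bold>\<longleftrightarrow>
        Ex_in 2 (rename (case_nat 1 (case_nat 0 (\<lambda>n. n + 3))) p))))"

definition ZF :: "fm set"
  where "ZF =
    {extensionality_ax, foundation_ax, pairing_ax, union_ax, power_set_ax, infinity_ax}
    \<union> range separation_ax \<union> range replacement_ax"


section \<open>Set-theoretic notions\<close>

definition is_upair :: "nat \<Rightarrow> nat \<Rightarrow> nat \<Rightarrow> fm"
  where "is_upair x y z = Forall (0 \<^bold>\<in> z + 1 \<^bold>\<longleftrightarrow> (0 \<^bold>= x + 1 \<^bold>\<or> 0 \<^bold>= y + 1))"

text \<open>\<open>z\<close> is the Kuratowski pair \<open>{{x}, {x, y}}\<close>.\<close>

definition is_pair :: "nat \<Rightarrow> nat \<Rightarrow> nat \<Rightarrow> fm"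
  where "is_pair x y z = Exists (Exists
    (is_upair (x + 2) (x + 2) 1 \<^bold>\<and> is_upair (x + 2) (y + 2) 0 \<^bold>\<and> is_upair 1 0 (z + 2)))"

text \<open>The pair of \<open>x\<close> and \<open>y\<close> is an element of \<open>r\<close>.\<close>

definition related :: "nat \<Rightarrow> nat \<Rightarrow> nat \<Rightarrow> fm"
  where "related r x y = Exists (is_pair (x + 1) (y + 1) 0 \<^bold>\<and> 0 \<^bold>\<in> r + 1)"

text \<open>\<open>r \<subseteq> x \<times> y\<close>; the innermost context is \<open>[b, a, pair]\<close>.\<close>

definition is_relation :: "nat \<Rightarrow> nat \<Rightarrow> nat \<Rightarrow> fm"
  where "is_relation r x y = All_in r (Ex_in (x + 1) (Ex_in (y + 2) (is_pair 1 0 2)))"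

text \<open>\<open>f : x \<rightarrow> y\<close>\<close>

definition is_function :: "nat \<Rightarrow> nat \<Rightarrow> nat \<Rightarrow> fm"
  where "is_function f x y =
    (is_relation f x y \<^bold>\<and>
     All_in x (Exists (related (f + 2) 1 0 \<^bold>\<and> Forall (related (f + 3) 2 0 \<^bold>\<longrightarrow> 0 \<^bold>= 1))))"

definition is_injection :: "nat \<Rightarrow> nat \<Rightarrow> nat \<Rightarrow> fm"
  where "is_injection f x y =
    (is_function f x y \<^bold>\<and>
     Forall (Forall (Forall (related (f + 3) 2 0 \<^bold>\<and> related (f + 3) 1 0 \<^bold>\<longrightarrow> 2 \<^bold>= 1))))"

definition is_bijection :: "nat \<Rightarrow> nat \<Rightarrow> nat \<Rightarrow> fm"
  where "is_bijection f x y =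
    (is_injection f x y \<^bold>\<and> All_in y (Ex_in (x + 1) (related (f + 2) 0 1)))"

text \<open>\<open>\<omega>\<close> is the least inductive set.\<close>

definition is_omega :: "nat \<Rightarrow> fm"
  where "is_omega x =
    (is_inductive x \<^bold>\<and> Forall (is_inductive 0 \<^bold>\<longrightarrow> is_subset (x + 1) 0))"

text \<open>Equinumerous with some \<open>n \<in> \<omega>\<close>; the innermost context is \<open>[f, n, \<omega>]\<close>.\<close>

definition is_finite :: "nat \<Rightarrow> fm"
  where "is_finite x =
    Exists (is_omega 0 \<^bold>\<and> Ex_in 0 (Exists (is_bijection 0 (x + 3) 1)))"

text \<open>Of size at most \<open>\<aleph>\<^sub>0\<close>; the innermost context is \<open>[f, \<omega>]\<close>.\<close>

definition is_countable :: "nat \<Rightarrow> fm"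
  where "is_countable x = Exists (is_omega 0 \<^bold>\<and> Exists (is_injection 0 (x + 2) 1))"

text \<open>
  A transitive set linearly ordered by membership; it is then well-ordered by membership because
  of the axiom of foundation.
\<close>

definition is_ordinal :: "nat \<Rightarrow> fm"
  where "is_ordinal x =
    (All_in x (is_subset 0 (x + 1)) \<^bold>\<and>
     All_in x (All_in (x + 1) (1 \<^bold>\<in> 0 \<^bold>\<or> 1 \<^bold>= 0 \<^bold>\<or> 0 \<^bold>\<in> 1)))"

text \<open>\<open>\<omega>\<^sub>1 = \<aleph>\<^sub>1\<close> is the least uncountable ordinal.\<close>

definition is_aleph1 :: "nat \<Rightarrow> fm"
  where "is_aleph1 x =
    (is_ordinal x \<^bold>\<and> \<^bold>\<not> is_countable x \<^bold>\<and> All_in x (is_countable 0))"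

text \<open>Equinumerous with \<open>\<aleph>\<^sub>1\<close>; the innermost context is \<open>[f, \<aleph>\<^sub>1]\<close>.\<close>

definition has_size_aleph1 :: "nat \<Rightarrow> fm"
  where "has_size_aleph1 x =
    Exists (is_aleph1 0 \<^bold>\<and> Exists (is_bijection 0 (x + 2) 1))"

text \<open>\<open>r\<close> is a (reflexive) partial order on the set \<open>x\<close>.\<close>

definition is_partial_order :: "nat \<Rightarrow> nat \<Rightarrow> fm"
  where "is_partial_order x r =
    (is_relation r x x \<^bold>\<and>
     All_in x (related (r + 1) 0 0) \<^bold>\<and>
     All_in x (All_in (x + 1)
       (related (r + 2) 1 0 \<^bold>\<and> related (r + 2) 0 1 \<^bold>\<longrightarrow> 1 \<^bold>= 0)) \<^bold>\<and>
     All_in x (All_in (x + 1) (All_in (x + 2)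
       (related (r + 3) 2 1 \<^bold>\<and> related (r + 3) 1 0 \<^bold>\<longrightarrow> related (r + 3) 2 0))))"

definition is_chain :: "nat \<Rightarrow> nat \<Rightarrow> nat \<Rightarrow> fm"
  where "is_chain c x r =
    (is_subset c x \<^bold>\<and>
     All_in c (All_in (c + 1) (related (r + 2) 1 0 \<^bold>\<or> related (r + 2) 0 1)))"

definition is_antichain :: "nat \<Rightarrow> nat \<Rightarrow> nat \<Rightarrow> fm"
  where "is_antichain c x r =
    (is_subset c x \<^bold>\<and>
     All_in c (All_in (c + 1)
       (\<^bold>\<not> 1 \<^bold>= 0 \<^bold>\<longrightarrow> \<^bold>\<not> (related (r + 2) 1 0 \<^bold>\<or> related (r + 2) 0 1))))"

text \<open>\<open>f\<close> is a function with domain \<open>x\<close> and \<open>f b \<in> b\<close> for all \<open>b \<in> x\<close>.\<close>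

definition is_choice_function :: "nat \<Rightarrow> nat \<Rightarrow> fm"
  where "is_choice_function f x =
    (Exists (is_function (f + 1) (x + 1) 0) \<^bold>\<and>
     All_in x (Forall (related (f + 2) 1 0 \<^bold>\<longrightarrow> 0 \<^bold>\<in> 1)))"


section \<open>The two principles\<close>

text \<open>\<open>CAC\<^sub>1\<close> for \<open>\<aleph>\<^sub>0\<close>; the context of the matrix is \<open>[order, set]\<close>.\<close>

definition CAC_1_aleph0 :: fm
  where "CAC_1_aleph0 =
    Forall (Forall
      (is_partial_order 1 0 \<^bold>\<and>
       Forall (is_antichain 0 2 1 \<^bold>\<longrightarrow> is_finite 0) \<^bold>\<and>
       Forall (is_chain 0 2 1 \<^bold>\<longrightarrow> is_countable 0)
       \<^bold>\<longrightarrow> is_countable 1))"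

text \<open>\<open>PAC\<close> for \<open>\<aleph>\<^sub>1\<close>-sized families of non-empty finite sets; the context is first \<open>[A]\<close>, then \<open>[B, A]\<close>.\<close>

definition PAC_fin_aleph1 :: fm
  where "PAC_fin_aleph1 =
    Forall
      (has_size_aleph1 0 \<^bold>\<and> All_in 0 (\<^bold>\<not> is_empty 0 \<^bold>\<and> is_finite 0) \<^bold>\<longrightarrow>
       Exists (is_subset 0 1 \<^bold>\<and> has_size_aleph1 0 \<^bold>\<and> Exists (is_choice_function 0 1)))"

end

theory Submission
  imports Defs "HOL-Library.Countable"
begin

text \<open>
  By completeness it suffices to argue in an arbitrary model of ZF.  Let \<open>F\<close> be a bijection from a
  family \<open>A\<close> of non-empty finite sets to \<open>\<omega>\<^sub>1\<close>, and order the disjoint union \<open>X\<close> of the members of \<open>A\<close>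
  by the \<open>F\<close>-indices of the members, distinct elements of the same member being incomparable.
  Antichains of \<open>X\<close> lie in one member of \<open>A\<close>, so they are finite.  A chain meets each member at most
  once, so it is a choice function on a subfamily \<open>B\<close>; if the chain is uncountable, then \<open>F\<close> maps \<open>B\<close>
  onto an uncountable subset of \<open>\<omega>\<^sub>1\<close>, whose Mostowski collapse is \<open>\<omega>\<^sub>1\<close>, so \<open>B\<close> has size \<open>\<aleph>\<^sub>1\<close>.  If
  all chains are countable, then \<open>X\<close> is countable, and an injection of \<open>X\<close> into \<open>\<omega>\<close> chooses an
  element from every member of \<open>A\<close>.
\<close>

section \<open>Renaming and derivability\<close>

text \<open>The model may be ill-founded from outside, its natural numbers may be nonstandard, and
  the term model to which the argument is finally applied is a quotient of \<open>nat\<close>. So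
  "uncountable" and "least" have only their internal meaning, and HOL's induction and choice cannot
  be applied to the model directly: a HOL set or function becomes an object of the model only once
  it is defined by a formula with parameters. Hence the calculus of definable predicates and terms,
  which feeds Separation, Foundation and internal induction. The collapse is needed because the
  family obtained from an uncountable chain is indexed by some uncountable subset of
  \<open>W\<close>, while size \<aleph>_1 asks for a bijection with all of \<open>W\<close>. Such a
  subset cannot collapse to a proper initial segment, as those are countable.\<close>

abbreviation lift :: "(nat \<Rightarrow> nat) \<Rightarrow> nat \<Rightarrow> nat"
  where "lift f \<equiv> case_nat 0 (\<lambda>n. Suc (f n))"

lemma rename_rename: "rename f (rename g p) = rename (\<lambda>n. f (g n)) p"
proof (induction p arbitrary: f g)
  case (Forall p)
  have "(\<lambda>n. lift f (lift g n)) = lift (\<lambda>n. f (g n))"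
    by (auto split: nat.split)
  with Forall show ?case by simp
qed auto

lemma rename_cong:
  assumes "\<And>i. i < arity p \<Longrightarrow> f i = g i"
  shows "rename f p = rename g p"
  using assms
proof (induction p arbitrary: f g)
  case (Forall p)
  have "lift f i = lift g i" if "i < arity p" for i
    using that Forall.prems[of "i - 1"] by (cases i) auto
  from Forall.IH[OF this] show ?case by simp
next
  case (Imp p q)
  have "rename f p = rename g p" "rename f q = rename g q"
    by (rule Imp.IH, use Imp.prems in simp)+
  then show ?case by simp
qed auto

lemma rename_ident: "rename (\<lambda>n. n) p = p"
proof (induction p)
  case (Forall p)
  have "lift (\<lambda>n. n) = (\<lambda>n. n)" by (auto split: nat.split)
  with Forall show ?case by simp
qed auto

lemma rename_inst: "rename f (inst x p) = inst (f x) (rename (lift f) p)"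
proof -
  have "(\<lambda>n. f (case_nat x (\<lambda>n. n) n)) = (\<lambda>n. case_nat (f x) (\<lambda>n. n) (lift f n))"
    by (auto split: nat.split)
  then show ?thesis by (simp add: inst_def rename_rename)
qed

section \<open>Structural properties of derivations\<close>

lemma derives_mono: "H \<turnstile> p \<Longrightarrow> H \<subseteq> G \<Longrightarrow> G \<turnstile> p"
proof (induction arbitrary: G rule: derives.induct)
  case (ImpI p H q)
  then show ?case by (meson derives.ImpI insert_mono)
next
  case (Contr p H)
  then show ?case by (meson derives.Contr insert_mono)
next
  case (ForallI H p)
  then show ?case by (meson derives.ForallI image_mono)
next
  case (ImpE H p q)
  then show ?case by (meson derives.ImpE)
next
  case (EqSubst H x y p)
  then show ?case by (meson derives.EqSubst)
qed (auto intro: derives.Assm derives.ForallE derives.EqRefl)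

text \<open>The eigenvariable stays fresh under every renaming, because \<open>lift f\<close> after
  \<open>Suc\<close> is \<open>Suc\<close> after \<open>f\<close>.\<close>

lemma derives_rename: "H \<turnstile> p \<Longrightarrow> rename f ` H \<turnstile> rename f p"
proof (induction arbitrary: f rule: derives.induct)
  case (ForallI H p)
  have "rename (lift f) ` rename Suc ` H = rename Suc ` rename f ` H"
    by (simp add: image_image rename_rename)
  with ForallI.IH[of "lift f"] show ?case by (auto intro: derives.ForallI)
next
  case (ForallE H p x)
  then show ?case by (simp add: rename_inst derives.ForallE)
next
  case (EqSubst H x y p)
  from EqSubst.IH[of f] show ?case by (simp add: rename_inst derives.EqSubst)
next
  case (Contr p H)
  then show ?case by (simp add: Not_fm_def derives.Contr)
next
  case (ImpE H p q)
  then show ?case by (simp, meson derives.ImpE)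
qed (simp_all add: derives.Assm derives.ImpI derives.EqRefl)

lemma derives_finite: "H \<turnstile> p \<Longrightarrow> \<exists>F. finite F \<and> F \<subseteq> H \<and> F \<turnstile> p"
proof (induction rule: derives.induct)
  case (Assm p H)
  then show ?case by (intro exI[of _ "{p}"]) (auto intro: derives.Assm)
next
  case (ImpI p H q)
  then obtain F where "finite F" "F \<subseteq> insert p H" "F \<turnstile> q" by blast
  moreover from this have "insert p (F - {p}) \<turnstile> q"
    by (auto elim: derives_mono)
  ultimately show ?case by (intro exI[of _ "F - {p}"]) (auto intro: derives.ImpI)
next
  case (ImpE H p q)
  then obtain F G where "finite F" "F \<subseteq> H" "F \<turnstile> (p \<^bold>\<longrightarrow> q)" "finite G" "G \<subseteq> H" "G \<turnstile> p"
    by blast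
  then show ?case
    by (intro exI[of _ "F \<union> G"]) (meson derives.ImpE derives_mono finite_Un Un_least sup_ge1 sup_ge2)
next
  case (Contr p H)
  then obtain F where "finite F" "F \<subseteq> insert (\<^bold>\<not> p) H" "F \<turnstile> Falsum" by blast
  moreover from this have "insert (\<^bold>\<not> p) (F - {\<^bold>\<not> p}) \<turnstile> Falsum"
    by (auto elim: derives_mono)
  ultimately show ?case by (intro exI[of _ "F - {\<^bold>\<not> p}"]) (auto intro: derives.Contr)
next
  case (ForallI H p)
  then obtain F where "finite F" "F \<subseteq> rename Suc ` H" "F \<turnstile> p" by blast
  then obtain G where "finite G" "G \<subseteq> H" "F = rename Suc ` G"
    by (meson finite_subset_image)
  with \<open>F \<turnstile> p\<close> show ?case by (auto intro: derives.ForallI)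
next
  case (EqSubst H x y p)
  then obtain F G where "finite F" "F \<subseteq> H" "F \<turnstile> (x \<^bold>= y)" "finite G" "G \<subseteq> H" "G \<turnstile> inst x p"
    by blast
  then show ?case
    by (intro exI[of _ "F \<union> G"]) (meson derives.EqSubst derives_mono finite_Un Un_least sup_ge1 sup_ge2)
qed (blast intro: derives.ForallE derives.EqRefl)+

lemma derives_cut: "insert p H \<turnstile> q \<Longrightarrow> H \<turnstile> p \<Longrightarrow> H \<turnstile> q"
  by (blast intro: derives.ImpI derives.ImpE)

lemma derives_exfalso: "H \<turnstile> Falsum \<Longrightarrow> H \<turnstile> p"
  by (meson derives.Contr derives_mono subset_insertI)

lemma derives_eq_sym:
  assumes "H \<turnstile> (x \<^bold>= y)"
  shows "H \<turnstile> (y \<^bold>= x)"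
  \<comment> \<open>In the template, index 0 is the place to be rewritten. \<open>inst\<close>
    lowers all other indices, so \<open>Suc x\<close> in it stands for \<open>x\<close>.\<close>
  using derives.EqSubst[OF assms, of "0 \<^bold>= Suc x"] by (simp add: inst_def derives.EqRefl)

lemma derives_eq_trans:
  assumes "H \<turnstile> (x \<^bold>= y)" "H \<turnstile> (y \<^bold>= z)"
  shows "H \<turnstile> (x \<^bold>= z)"
  using derives.EqSubst[OF assms(2), of "Suc x \<^bold>= 0"] assms(1) by (simp add: inst_def)

lemma derives_Member_cong:
  assumes "H \<turnstile> (x \<^bold>= x')" "H \<turnstile> (y \<^bold>= y')" "H \<turnstile> (x \<^bold>\<in> y)"
  shows "H \<turnstile> (x' \<^bold>\<in> y')"
proof -
  have "H \<turnstile> (x' \<^bold>\<in> y)"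
    using derives.EqSubst[OF assms(1), of "0 \<^bold>\<in> Suc y"] assms(3) by (simp add: inst_def)
  then show ?thesis
    using derives.EqSubst[OF assms(2), of "Suc x' \<^bold>\<in> 0"] by (simp add: inst_def)
qed

text \<open>\<open>ForallI\<close> wants the eigenvariable at index 0, so the fresh variable
  \<open>k\<close> is moved there and all others are shifted. On the assumptions, whose indices lie
  below \<open>k\<close>, this is the plain shift; on \<open>inst k p\<close> it undoes the
  instantiation.\<close>

lemma derives_fresh:
  assumes "H \<turnstile> inst k p" and "\<And>q. q \<in> H \<Longrightarrow> arity q \<le> k" and "arity p \<le> Suc k"
  shows "H \<turnstile> Forall p"
proof -
  define f where "f = (\<lambda>n. if n = k then 0 else Suc n)"
  have "rename f ` H = rename Suc ` H"
  proof (rule image_cong)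
    fix q assume "q \<in> H"
    with assms(2) show "rename f q = rename Suc q"
      by (intro rename_cong) (use f_def less_le_trans in fastforce)
  qed simp
  moreover have "rename f (inst k p) = p"
  proof -
    have "rename (\<lambda>n. f (case_nat k (\<lambda>n. n) n)) p = rename (\<lambda>n. n) p"
      using assms(3) by (intro rename_cong) (auto simp: f_def split: nat.split)
    then show ?thesis by (simp add: inst_def rename_rename rename_ident)
  qed
  ultimately show ?thesis
    using derives_rename[OF assms(1), of f] by (auto intro: derives.ForallI)
qed


section \<open>Completeness\<close>

instance fm :: countable
  by countable_datatype

primrec sat :: "('a \<Rightarrow> 'a \<Rightarrow> bool) \<Rightarrow> (nat \<Rightarrow> 'a) \<Rightarrow> fm \<Rightarrow> bool" where
  "sat E e (x \<^bold>\<in> y) = E (e x) (e y)"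
| "sat E e (x \<^bold>= y) = (e x = e y)"
| "sat E e Falsum = False"
| "sat E e (p \<^bold>\<longrightarrow> q) = (sat E e p \<longrightarrow> sat E e q)"
| "sat E e (Forall p) = (\<forall>x. sat E (case_nat x e) p)"

text \<open>In \<open>henkin_chain\<close>, the witness \<open>k\<close> bounds all arities and is therefore a fresh variable.\<close>

definition witness_step :: "nat \<Rightarrow> fm \<Rightarrow> fm set"
  where "witness_step k p = insert p {\<^bold>\<not> inst k q |q. p = (\<^bold>\<not> Forall q)}"

primrec henkin_chain :: "fm set \<Rightarrow> nat \<Rightarrow> fm set" where
  "henkin_chain H 0 = H"
| "henkin_chain H (Suc n) =
    (let S = henkin_chain H n; p = from_nat n in
     if insert p S \<turnstile> Falsum then S
     else S \<union> witness_step (SOME k. \<forall>q\<in>insert p S. arity q \<le> k) p)"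

definition henkin :: "fm set \<Rightarrow> fm set"
  where "henkin H = (\<Union>n. henkin_chain H n)"

text \<open>This guarantees a fresh witness at every stage, even though the theory is infinite: its
  formulas are closed, and each stage adds only finitely many formulas.\<close>

lemma henkin_chain_bounded:
  assumes "\<And>q. q \<in> H \<Longrightarrow> arity q = 0"
  shows "\<exists>k. \<forall>q\<in>henkin_chain H n. arity q \<le> k"
proof (induction n)
  case 0
  with assms show ?case by auto
next
  case (Suc n)
  have "finite (witness_step k p)" for k p
  proof -
    \<comment> \<open>There is at most one such \<open>q\<close>. The case expression computes its
      instance; the value \<open>p\<close> in the other cases is arbitrary.\<close>
    have "{\<^bold>\<not> inst k q |q. p = (\<^bold>\<not> Forall q)} \<subseteq> {case p of (Forall q \<^bold>\<longrightarrow> _) \<Rightarrow> \<^bold>\<not> inst k q | _ \<Rightarrow> p}"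
      by (auto simp: Not_fm_def)
    then show ?thesis
      unfolding witness_step_def by (meson finite.simps finite_subset)
  qed
  then have "\<exists>l. \<forall>q\<in>witness_step k p. arity q \<le> l" for k p
    by (meson finite_nat_set_iff_bounded_le finite_imageI imageI)
  with Suc show ?case
    by (simp add: Let_def ball_Un) (meson le_trans nat_le_linear)
qed

lemma henkin_chain_mono: "m \<le> n \<Longrightarrow> henkin_chain H m \<subseteq> henkin_chain H n"
  by (rule lift_Suc_mono_le[of "henkin_chain H"]) (auto simp: Let_def)

text \<open>If the witness formula for a consistent \<open>\<not> Forall q\<close> led to a
  contradiction, \<open>inst k q\<close> would be derivable for the fresh \<open>k\<close>, hence
  also \<open>Forall q\<close>.\<close>

lemma henkin_chain_consistent:
  assumes closed: "\<And>q. q \<in> H \<Longrightarrow> arity q = 0" and cons: "\<not> H \<turnstile> Falsum"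
  shows "\<not> henkin_chain H n \<turnstile> Falsum"
proof (induction n)
  case 0
  with cons show ?case by simp
next
  case (Suc n)
  define S p where "S = henkin_chain H n" and "p = (from_nat n :: fm)"
  define k where "k = (SOME k. \<forall>q\<in>insert p S. arity q \<le> k)"
  show ?case
  proof (cases "insert p S \<turnstile> Falsum")
    case True
    with Suc show ?thesis by (simp add: S_def p_def)
  next
    case False
    have "\<exists>k. \<forall>q\<in>insert p S. arity q \<le> k"
      using henkin_chain_bounded[OF closed, where n = n] unfolding S_def
      by (metis insert_iff le_trans nat_le_linear)
    then have k: "\<forall>q\<in>insert p S. arity q \<le> k"
      unfolding k_def by (rule someI_ex)
    have "\<not> S \<union> witness_step k p \<turnstile> Falsum"
    proof (cases "\<exists>q. p = (\<^bold>\<not> Forall q)")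
      case True
      then obtain q where p: "p = (\<^bold>\<not> Forall q)" by blast
      have "\<not> insert (\<^bold>\<not> inst k q) (insert p S) \<turnstile> Falsum"
      proof
        assume "insert (\<^bold>\<not> inst k q) (insert p S) \<turnstile> Falsum"
        then have "insert p S \<turnstile> inst k q" by (rule derives.Contr)
        then have "insert p S \<turnstile> Forall q"
          by (rule derives_fresh) (use k p in \<open>auto simp: Not_fm_def\<close>)
        moreover have "insert p S \<turnstile> (Forall q \<^bold>\<longrightarrow> Falsum)"
          using p by (auto intro: derives.Assm simp: Not_fm_def)
        ultimately show False using False by (blast intro: derives.ImpE)
      qed
      moreover have "S \<union> witness_step k p = insert (\<^bold>\<not> inst k q) (insert p S)"
        using p by (auto simp: witness_step_def Not_fm_def)
      ultimately show ?thesis by simp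
    next
      case no_witness: False
      then have "S \<union> witness_step k p = insert p S"
        by (auto simp: witness_step_def)
      with False show ?thesis by simp
    qed
    with False show ?thesis
      unfolding k_def S_def p_def by (simp add: Let_def)
  qed
qed

text \<open>A refutation uses finitely many assumptions; since the stages increase, one consistent
  stage contains them all.\<close>

lemma henkin_consistent:
  assumes "\<And>q. q \<in> H \<Longrightarrow> arity q = 0" and "\<not> H \<turnstile> Falsum"
  shows "\<not> henkin H \<turnstile> Falsum"
proof
  assume "henkin H \<turnstile> Falsum"
  then obtain F where F: "finite F" "F \<subseteq> henkin H" "F \<turnstile> Falsum"
    using derives_finite by blast
  have "\<exists>n. F \<subseteq> henkin_chain H n"
    using F(1,2)
  proof (induction F)
    case (insert p F)
    then obtain m n where "F \<subseteq> henkin_chain H m" "p \<in> henkin_chain H n"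
      unfolding henkin_def by auto
    then have "insert p F \<subseteq> henkin_chain H (max m n)"
      using henkin_chain_mono[of m "max m n" H] henkin_chain_mono[of n "max m n" H] by auto
    then show ?case by blast
  qed simp
  with F(3) henkin_chain_consistent[OF assms] show False
    using derives_mono by blast
qed

lemma henkin_extends: "H \<subseteq> henkin H"
  unfolding henkin_def using henkin_chain.simps(1) by blast

text \<open>The formula with code \<open>n\<close> is considered at stage \<open>n\<close>: either
  it is added there, or its refutation is a derivation of its negation.\<close>

lemma henkin_decides: "henkin H \<turnstile> p \<or> henkin H \<turnstile> (\<^bold>\<not> p)"
proof (cases "insert p (henkin_chain H (to_nat p)) \<turnstile> Falsum")
  case True
  then have "insert p (henkin H) \<turnstile> Falsum"
    by (rule derives_mono) (auto simp: henkin_def)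
  then show ?thesis
    by (auto simp: Not_fm_def intro: derives.ImpI)
next
  case False
  then have "p \<in> henkin_chain H (Suc (to_nat p))"
    by (simp add: Let_def witness_step_def)
  then show ?thesis
    unfolding henkin_def by (blast intro: derives.Assm)
qed

lemma henkin_witness:
  assumes cons: "\<not> henkin H \<turnstile> Falsum" and p: "henkin H \<turnstile> (\<^bold>\<not> Forall p)"
  shows "\<exists>k. henkin H \<turnstile> (\<^bold>\<not> inst k p)"
proof -
  define n where "n = to_nat (\<^bold>\<not> Forall p)"
  have "\<not> insert (\<^bold>\<not> Forall p) (henkin_chain H n) \<turnstile> Falsum"
  proof
    assume "insert (\<^bold>\<not> Forall p) (henkin_chain H n) \<turnstile> Falsum"
    then have "insert (\<^bold>\<not> Forall p) (henkin H) \<turnstile> Falsum"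
      by (rule derives_mono) (auto simp: henkin_def)
    with p cons show False by (blast intro: derives_cut)
  qed
  then have "\<exists>k. (\<^bold>\<not> inst k p) \<in> henkin_chain H (Suc n)"
    by (auto simp: Let_def witness_step_def n_def)
  then show ?thesis
    unfolding henkin_def by (blast intro: derives.Assm)
qed

lemma henkin_Imp:
  assumes "\<not> henkin H \<turnstile> Falsum"
  shows "henkin H \<turnstile> (p \<^bold>\<longrightarrow> q) \<longleftrightarrow> (henkin H \<turnstile> p \<longrightarrow> henkin H \<turnstile> q)"
proof (intro iffI impI)
  assume "henkin H \<turnstile> p \<longrightarrow> henkin H \<turnstile> q"
  then consider "henkin H \<turnstile> q" | "henkin H \<turnstile> (\<^bold>\<not> p)"
    using henkin_decides by blast
  then show "henkin H \<turnstile> (p \<^bold>\<longrightarrow> q)"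
  proof cases
    case 1
    then show ?thesis by (meson derives.ImpI derives_mono subset_insertI)
  next
    case 2
    then have "insert p (henkin H) \<turnstile> (p \<^bold>\<longrightarrow> Falsum)"
      unfolding Not_fm_def by (rule derives_mono) auto
    then have "insert p (henkin H) \<turnstile> Falsum"
      by (rule derives.ImpE) (simp add: derives.Assm)
    then show ?thesis by (blast intro: derives.ImpI derives_exfalso)
  qed
qed (blast intro: derives.ImpE)

lemma henkin_Forall:
  assumes "\<not> henkin H \<turnstile> Falsum"
  shows "henkin H \<turnstile> Forall p \<longleftrightarrow> (\<forall>k. henkin H \<turnstile> inst k p)"
proof (intro iffI allI)
  assume *: "\<forall>k. henkin H \<turnstile> inst k p"
  show "henkin H \<turnstile> Forall p"
  proof (rule ccontr)
    assume "\<not> henkin H \<turnstile> Forall p"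
    then obtain k where "henkin H \<turnstile> (\<^bold>\<not> inst k p)"
      using henkin_decides henkin_witness[OF assms] by blast
    with * have "henkin H \<turnstile> Falsum"
      unfolding Not_fm_def by (blast intro: derives.ImpE)
    with assms show False ..
  qed
qed (blast intro: derives.ForallE)

text \<open>The truth lemma for the term model. The map \<open>cls\<close> to the classes is
  abstract because the quotient type is formed later, for one fixed theory; the renaming
  \<open>f\<close> lets the induction pass under a quantifier, where the environment
  changes.\<close>

lemma henkin_model:
  fixes cls :: "nat \<Rightarrow> 'a"
  assumes cons: "\<not> henkin H \<turnstile> Falsum"
    and surj: "surj cls"
    and eq: "\<And>x y. cls x = cls y \<longleftrightarrow> henkin H \<turnstile> (x \<^bold>= y)"
    and E: "\<And>x y. E (cls x) (cls y) \<longleftrightarrow> henkin H \<turnstile> (x \<^bold>\<in> y)"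
  shows "sat E (\<lambda>n. cls (f n)) p \<longleftrightarrow> henkin H \<turnstile> rename f p"
proof (induction p arbitrary: f)
  case (Forall p)
  have "case_nat (cls k) (\<lambda>n. cls (f n)) = (\<lambda>n. cls (case_nat k f n))" for k
    by (auto split: nat.split)
  moreover have "rename (case_nat k f) p = inst k (rename (lift f) p)" for k
  proof -
    have "case_nat k f = (\<lambda>n. case_nat k (\<lambda>n. n) (lift f n))"
      by (auto split: nat.split)
    then show ?thesis by (simp add: inst_def rename_rename)
  qed
  ultimately have "sat E (\<lambda>n. cls (f n)) (Forall p) \<longleftrightarrow> (\<forall>k. henkin H \<turnstile> inst k (rename (lift f) p))"
    using Forall surj by (metis sat.simps(5) surjD)
  then show ?case by (simp add: henkin_Forall[OF cons])
qed (use cons in \<open>simp_all add: eq E henkin_Imp[OF cons]\<close>)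

section \<open>Satisfaction under renaming, universal closure and change of environment\<close>

lemma sat_rename: "sat E e (rename f p) = sat E (\<lambda>n. e (f n)) p"
proof (induction p arbitrary: e f)
  case (Forall p)
  have "(\<lambda>n. case_nat x e (lift f n)) = case_nat x (\<lambda>n. e (f n))" for x
    by (auto split: nat.split)
  with Forall show ?case by simp
qed auto

lemma arity_Forall_pow: "arity ((Forall ^^ n) p) = arity p - n"
  by (induction n) auto

lemma arity_univ_closure: "arity (univ_closure p) = 0"
  by (simp add: univ_closure_def arity_Forall_pow)

lemma sat_Forall_pow:
  assumes "\<And>e. sat E e ((Forall ^^ n) p)"
  shows "sat E e p"
  using assms
proof (induction n arbitrary: e)
  case (Suc n)
  have "sat E e ((Forall ^^ n) p)" for e
  proof -
    have "case_nat (e 0) (\<lambda>n. e (Suc n)) = e"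
      by (auto split: nat.split)
    with Suc.prems[of "\<lambda>n. e (Suc n)"] show ?thesis
      by (simp only: funpow.simps comp_apply sat.simps) (metis (no_types))
  qed
  with Suc.IH show ?case by blast
qed auto

lemma sat_univ_closure: "(\<And>e. sat E e (univ_closure p)) \<Longrightarrow> sat E e p"
  unfolding univ_closure_def by (rule sat_Forall_pow)

lemma sat_cong:
  assumes "\<And>i. i < arity p \<Longrightarrow> e i = e' i"
  shows "sat E e p = sat E e' p"
  using assms
proof (induction p arbitrary: e e')
  case (Forall p)
  have "case_nat x e i = case_nat x e' i" if "i < arity p" for x i
    using that Forall.prems[of "i - 1"] by (cases i) auto
  from Forall.IH[OF this] show ?case by simp
next
  case (Imp p q)
  have "sat E e p = sat E e' p" "sat E e q = sat E e' q"
    by (rule Imp.IH, use Imp.prems in simp)+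
  then show ?case by simp
qed auto

lemma sat_closed: "arity p = 0 \<Longrightarrow> sat E e p = sat E e' p"
  by (rule sat_cong) simp

section \<open>Definability in a model of ZF\<close>

lemma sat_simps [simp]:
  "sat E e (\<^bold>\<not> p) = (\<not> sat E e p)"
  "sat E e (p \<^bold>\<or> q) = (sat E e p \<or> sat E e q)"
  "sat E e (p \<^bold>\<and> q) = (sat E e p \<and> sat E e q)"
  "sat E e (p \<^bold>\<longleftrightarrow> q) = (sat E e p = sat E e q)"
  "sat E e (Exists p) = (\<exists>x. sat E (case_nat x e) p)"
  by (auto simp: Not_fm_def Or_fm_def And_fm_def Iff_fm_def Exists_def)

locale zf_model =
  fixes E :: "'a \<Rightarrow> 'a \<Rightarrow> bool"
  assumes sat_ZF: "p \<in> ZF \<Longrightarrow> sat E e p"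
begin

definition elts :: "'a \<Rightarrow> 'a set"
  where "elts a = {x. E x a}"

lemma sat_bounded [simp]:
  "sat E e (x \<^bold>\<in> y) = (e x \<in> elts (e y))"
  "sat E e (All_in x p) = (\<forall>z\<in>elts (e x). sat E (case_nat z e) p)"
  "sat E e (Ex_in x p) = (\<exists>z\<in>elts (e x). sat E (case_nat z e) p)"
  by (auto simp: All_in_def Ex_in_def elts_def)

declare sat.simps(1) [simp del]

text \<open>
  A predicate on environments is definable if it is given by a formula whose variables are
  interpreted by entries of the environment (\<open>Inr\<close>) or by fixed elements of the model (\<open>Inl\<close>).
\<close>

definition val :: "(nat \<Rightarrow> 'a + nat) \<Rightarrow> (nat \<Rightarrow> 'a) \<Rightarrow> nat \<Rightarrow> 'a"
  where "val s e n = (case s n of Inl c \<Rightarrow> c | Inr k \<Rightarrow> e k)"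

definition dpred :: "((nat \<Rightarrow> 'a) \<Rightarrow> bool) \<Rightarrow> bool"
  where "dpred P \<longleftrightarrow> (\<exists>p s. \<forall>e. P e = sat E (val s e) p)"

text \<open>The language has no function symbols, so a term can only be defined through its graph,
  with the value at index 0.\<close>

definition dterm :: "((nat \<Rightarrow> 'a) \<Rightarrow> 'a) \<Rightarrow> bool"
  where "dterm t \<longleftrightarrow> dpred (\<lambda>e. e 0 = t (\<lambda>n. e (Suc n)))"

named_theorems definable

section \<open>Closure properties of definable predicates and terms\<close>

lemma dpred_const [definable]: "dpred (\<lambda>e. b)"
  unfolding dpred_def by (rule exI[of _ "if b then Falsum \<^bold>\<longrightarrow> Falsum else Falsum"]) auto

lemma dpred_mem_var: "dpred (\<lambda>e. e i \<in> elts (e j))"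
  unfolding dpred_def by (intro exI[of _ "i \<^bold>\<in> j"] exI[of _ Inr]) (auto simp: val_def)

lemma dpred_eq_var: "dpred (\<lambda>e. e i = e j)"
  unfolding dpred_def by (intro exI[of _ "i \<^bold>= j"] exI[of _ Inr]) (auto simp: val_def)

lemma dpred_eq_const: "dpred (\<lambda>e. e i = c)"
  unfolding dpred_def
  by (intro exI[of _ "0 \<^bold>= 1"] exI[of _ "case_nat (Inr i) (\<lambda>_. Inl c)"]) (auto simp: val_def)

lemma dpred_imp [definable]:
  assumes "dpred P" "dpred Q"
  shows "dpred (\<lambda>e. P e \<longrightarrow> Q e)"
proof -
  obtain p s q t where p: "\<And>e. P e = sat E (val s e) p" and q: "\<And>e. Q e = sat E (val t e) q"
    using assms unfolding dpred_def by blast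
  \<comment> \<open>The two formulas may interpret the same variable differently, so they are moved
    to the even and the odd variables.\<close>
  define u where "u n = (if even n then s (n div 2) else t (n div 2))" for n
  have "(\<lambda>n. val u e (2 * n)) = val s e" "(\<lambda>n. val u e (Suc (2 * n))) = val t e" for e
    by (auto simp: val_def u_def)
  then have "(P e \<longrightarrow> Q e) = sat E (val u e) (rename (\<lambda>n. 2 * n) p \<^bold>\<longrightarrow> rename (\<lambda>n. Suc (2 * n)) q)" for e
    by (simp add: p q sat_rename)
  then show ?thesis unfolding dpred_def by blast
qed

lemma dpred_subst:
  assumes "dpred P"
  shows "dpred (\<lambda>e. P (\<lambda>n. e (f n)))"
proof -
  obtain p s where p: "\<And>e. P e = sat E (val s e) p"
    using assms unfolding dpred_def by blast
  have "val s (\<lambda>n. e (f n)) = val (\<lambda>n. map_sum id f (s n)) e" for e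
    by (auto simp: val_def split: sum.split)
  then show ?thesis unfolding dpred_def p by metis
qed

text \<open>The premise has the bound variable at index 0 and the old environment shifted by one, so
  that repeated resolution with the \<open>definable\<close> rules follows the syntax of a HOL
  expression.\<close>

lemma dpred_all [definable]:
  assumes "dpred (\<lambda>e. Q (\<lambda>n. e (Suc n)) (e 0))"
  shows "dpred (\<lambda>e. \<forall>x. Q e x)"
proof -
  obtain p s where p: "\<And>e. Q (\<lambda>n. e (Suc n)) (e 0) = sat E (val s e) p"
    using assms unfolding dpred_def by blast
  \<comment> \<open>Several variables of \<open>p\<close> may be interpreted by entry 0. All of them
    are identified with the new bound variable, and the others make room for it.\<close>
  define r where "r n = (case s n of Inl c \<Rightarrow> Suc n | Inr 0 \<Rightarrow> 0 | Inr (Suc k) \<Rightarrow> Suc n)" for n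
  define t where "t n = (case s n of Inl c \<Rightarrow> Inl c | Inr k \<Rightarrow> Inr (k - 1))" for n
  have "val s (case_nat x e) = (\<lambda>n. case_nat x (val t e) (r n))" for x e
    by (auto simp: val_def r_def t_def split: sum.split nat.split)
  then have "(\<forall>x. Q e x) = sat E (val t e) (Forall (rename r p))" for e
    using p[of "case_nat _ e"] by (simp add: sat_rename)
  then show ?thesis unfolding dpred_def by blast
qed

lemma dpred_not [definable]: "dpred P \<Longrightarrow> dpred (\<lambda>e. \<not> P e)"
  using dpred_imp[OF _ dpred_const[of False]] by simp

lemma dpred_and [definable]: "dpred P \<Longrightarrow> dpred Q \<Longrightarrow> dpred (\<lambda>e. P e \<and> Q e)"
  using dpred_not[OF dpred_imp[OF _ dpred_not]] by simp

lemma dpred_or [definable]: "dpred P \<Longrightarrow> dpred Q \<Longrightarrow> dpred (\<lambda>e. P e \<or> Q e)"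
  using dpred_imp[OF dpred_not] by (simp add: disj_imp)

lemma dpred_iff [definable]: "dpred P \<Longrightarrow> dpred Q \<Longrightarrow> dpred (\<lambda>e. P e = Q e)"
  unfolding iff_conv_conj_imp by (intro dpred_and dpred_imp)

lemma dpred_ex [definable]:
  assumes "dpred (\<lambda>e. Q (\<lambda>n. e (Suc n)) (e 0))"
  shows "dpred (\<lambda>e. \<exists>x. Q e x)"
  using dpred_not[OF dpred_all[OF dpred_not[OF assms]]] by simp

lemma dterm_subst: "dterm t \<Longrightarrow> dterm (\<lambda>e. t (\<lambda>n. e (f n)))"
  unfolding dterm_def
  by (drule dpred_subst[where f = "case_nat 0 (\<lambda>n. Suc (f n))"]) simp

text \<open>A term inside a predicate is eliminated by quantifying over its value.\<close>

lemma dpred_let: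
  assumes "dpred (\<lambda>e. Q (\<lambda>n. e (Suc n)) (e 0))" "dterm t"
  shows "dpred (\<lambda>e. Q e (t e))"
proof -
  have "dpred (\<lambda>e. \<exists>x. x = t e \<and> Q e x)"
    by (intro dpred_ex dpred_and assms(1) assms(2)[unfolded dterm_def])
  then show ?thesis by simp
qed

lemma dpred_comp2:
  assumes "dpred (\<lambda>e. R (e 0) (e (Suc 0)))" "dterm t" "dterm u"
  shows "dpred (\<lambda>e. R (t e) (u e))"
proof -
  \<comment> \<open>The last argument is replaced first, so it has to sit at index 0.\<close>
  have "dpred (\<lambda>e. R (e (Suc 0)) (e 0))"
    using dpred_subst[OF assms(1), of "case_nat 1 (\<lambda>_. 0)"] by simp
  then have "dpred (\<lambda>e. R (e 0) (u (\<lambda>n. e (Suc n))))"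
    by (rule dpred_let[where Q = "\<lambda>e. R (e 0)"]) (rule dterm_subst[OF assms(3)])
  then show ?thesis
    by (rule dpred_let[where Q = "\<lambda>e x. R x (u e)"]) (rule assms(2))
qed

lemma dpred_comp3:
  assumes "dpred (\<lambda>e. R (e 0) (e (Suc 0)) (e (Suc (Suc 0))))" "dterm t" "dterm u" "dterm v"
  shows "dpred (\<lambda>e. R (t e) (u e) (v e))"
proof -
  have "dpred (\<lambda>e. R (e (Suc (Suc 0))) (e (Suc 0)) (e 0))"
    using dpred_subst[OF assms(1), of "case_nat 2 (case_nat 1 (\<lambda>_. 0))"] by (simp add: numeral_2_eq_2)
  then have "dpred (\<lambda>e. R (e (Suc 0)) (e 0) (v (\<lambda>n. e (Suc (Suc n)))))"
    by (rule dpred_let[where Q = "\<lambda>e. R (e (Suc 0)) (e 0)"])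
      (rule dterm_subst[OF assms(4)])
  then have "dpred (\<lambda>e. R (e 0) (u (\<lambda>n. e (Suc n))) (v (\<lambda>n. e (Suc n))))"
    by (rule dpred_let[where Q = "\<lambda>e y. R (e 0) y (v (\<lambda>n. e (Suc n)))"])
      (rule dterm_subst[OF assms(3)])
  then show ?thesis
    by (rule dpred_let[where Q = "\<lambda>e x. R x (u e) (v e)"]) (rule assms(2))
qed

lemma dterm_const [definable]: "dterm (\<lambda>e. c)"
  unfolding dterm_def by (rule dpred_eq_const)

lemma dterm_var [definable]: "dterm (\<lambda>e. e k)"
  unfolding dterm_def by (rule dpred_eq_var)

lemma dpred_eq [definable]: "dterm t \<Longrightarrow> dterm u \<Longrightarrow> dpred (\<lambda>e. t e = u e)"
  by (rule dpred_comp2[where R = "(=)"]) (rule dpred_eq_var)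

lemma dpred_mem [definable]: "dterm t \<Longrightarrow> dterm u \<Longrightarrow> dpred (\<lambda>e. t e \<in> elts (u e))"
  by (rule dpred_comp2[where R = "\<lambda>x y. x \<in> elts y"]) (rule dpred_mem_var)

lemma dterm_comp:
  assumes "dterm (\<lambda>e. h (e 0))" "dterm t"
  shows "dterm (\<lambda>e. h (t e))"
proof -
  have "dpred (\<lambda>e. e 0 = h (t (\<lambda>n. e (Suc n))))"
    using assms(1) unfolding dterm_def
    by (rule dpred_comp2[where R = "\<lambda>z x. z = h x"]) (rule dterm_var dterm_subst[OF assms(2)])+
  then show ?thesis by (simp add: dterm_def)
qed

lemma dterm_comp2:
  assumes "dterm (\<lambda>e. h (e 0) (e (Suc 0)))" "dterm t" "dterm u"
  shows "dterm (\<lambda>e. h (t e) (u e))"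
proof -
  have "dpred (\<lambda>e. e 0 = h (t (\<lambda>n. e (Suc n))) (u (\<lambda>n. e (Suc n))))"
    using assms(1) unfolding dterm_def
    by (rule dpred_comp3[where R = "\<lambda>z x y. z = h x y"])
      (rule dterm_var dterm_subst[OF assms(2)] dterm_subst[OF assms(3)])+
  then show ?thesis by (simp add: dterm_def)
qed

lemma dpred_mem_Collect [definable]:
  "dpred (\<lambda>e. Q e (t e)) \<Longrightarrow> dpred (\<lambda>e. t e \<in> {x. Q e x})"
  by simp

lemma dpred_mem_insert [definable]:
  "dterm t \<Longrightarrow> dterm u \<Longrightarrow> dpred (\<lambda>e. t e \<in> A e) \<Longrightarrow> dpred (\<lambda>e. t e \<in> insert (u e) (A e))"
  unfolding insert_iff by (intro dpred_or dpred_eq)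

lemma dpred_mem_empty [definable]: "dpred (\<lambda>e. t e \<in> {})"
  by (simp add: dpred_const)

lemma dpred_mem_Int [definable]:
  "dpred (\<lambda>e. t e \<in> A e) \<Longrightarrow> dpred (\<lambda>e. t e \<in> B e) \<Longrightarrow> dpred (\<lambda>e. t e \<in> A e \<inter> B e)"
  unfolding Int_iff by (intro dpred_and)

lemma dpred_mem_Diff [definable]:
  "dpred (\<lambda>e. t e \<in> A e) \<Longrightarrow> dpred (\<lambda>e. t e \<in> B e) \<Longrightarrow> dpred (\<lambda>e. t e \<in> A e - B e)"
  unfolding Diff_iff by (intro dpred_and dpred_not)

lemma dpred_ball [definable]:
  "dpred (\<lambda>e. e 0 \<in> A (\<lambda>n. e (Suc n))) \<Longrightarrow> dpred (\<lambda>e. Q (\<lambda>n. e (Suc n)) (e 0)) \<Longrightarrow>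
    dpred (\<lambda>e. \<forall>x\<in>A e. Q e x)"
  unfolding Ball_def by (intro dpred_all dpred_imp)

lemma dpred_bex [definable]:
  "dpred (\<lambda>e. e 0 \<in> A (\<lambda>n. e (Suc n))) \<Longrightarrow> dpred (\<lambda>e. Q (\<lambda>n. e (Suc n)) (e 0)) \<Longrightarrow>
    dpred (\<lambda>e. \<exists>x\<in>A e. Q e x)"
  unfolding Bex_def by (intro dpred_ex dpred_and)

lemma dpred_subset [definable]:
  "dpred (\<lambda>e. e 0 \<in> A (\<lambda>n. e (Suc n))) \<Longrightarrow> dpred (\<lambda>e. e 0 \<in> B (\<lambda>n. e (Suc n))) \<Longrightarrow>
    dpred (\<lambda>e. A e \<subseteq> B e)"
  unfolding subset_iff by (intro dpred_all dpred_imp)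

lemma dpred_set_eq [definable]:
  "dpred (\<lambda>e. e 0 \<in> A (\<lambda>n. e (Suc n))) \<Longrightarrow> dpred (\<lambda>e. e 0 \<in> B (\<lambda>n. e (Suc n))) \<Longrightarrow>
    dpred (\<lambda>e. A e = B e)"
  for A B :: "(nat \<Rightarrow> 'a) \<Rightarrow> 'a set"
  unfolding set_eq_iff by (intro dpred_all dpred_iff)

lemma dterm_if [definable]:
  assumes "dpred P" "dterm t" "dterm u"
  shows "dterm (\<lambda>e. if P e then t e else u e)"
proof -
  have "dpred (\<lambda>e. (P (\<lambda>n. e (Suc n)) \<longrightarrow> e 0 = t (\<lambda>n. e (Suc n))) \<and>
      (\<not> P (\<lambda>n. e (Suc n)) \<longrightarrow> e 0 = u (\<lambda>n. e (Suc n))))"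
    by (intro dpred_and dpred_imp dpred_not dpred_subst[OF assms(1)]
        assms(2,3)[unfolded dterm_def])
  then show ?thesis unfolding dterm_def by (simp only: if_split[of "\<lambda>x. _ = x"])
qed

text \<open>
  Definite description with a fixed value in the case of failure, which makes it definable; \<open>THE\<close>
  gives an unknown element that may vary with the predicate.
\<close>

definition desc :: "('a \<Rightarrow> bool) \<Rightarrow> 'a"
  where "desc P = (if \<exists>!x. P x then THE x. P x else undefined)"

lemma desc_eq: "P x \<Longrightarrow> (\<And>y. P y \<Longrightarrow> y = x) \<Longrightarrow> desc P = x"
  unfolding desc_def by (metis the_equality)

lemma dterm_desc [definable]:
  assumes "dpred (\<lambda>e. Q (\<lambda>n. e (Suc n)) (e 0))"
  shows "dterm (\<lambda>e. desc (Q e))"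
proof -
  \<comment> \<open>First-order form of the graph of \<open>desc\<close>; the failure value
    \<open>undefined\<close> enters as a fixed parameter.\<close>
  have "x = desc P \<longleftrightarrow> (P x \<and> (\<forall>y. P y \<longrightarrow> y = x)) \<or>
      (\<not> (\<exists>z. P z \<and> (\<forall>y. P y \<longrightarrow> y = z)) \<and> x = undefined)" for x P
    unfolding desc_def by (smt (verit) theI')
  moreover have "dpred (\<lambda>e. Q (\<lambda>n. e (Suc (Suc n))) (e 0))"
    using dpred_subst[OF assms, of "case_nat 0 (\<lambda>n. Suc (Suc n))"] by simp
  moreover have "dpred (\<lambda>e. Q (\<lambda>n. e (Suc (Suc (Suc n)))) (e 0))"
    using dpred_subst[OF assms, of "case_nat 0 (\<lambda>n. Suc (Suc (Suc n)))"] by simp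
  ultimately show ?thesis
    unfolding dterm_def by simp (intro definable assms; assumption)
qed


section \<open>Set theory inside the model\<close>

lemma elts_inject: "elts a = elts b \<longleftrightarrow> a = b"
proof
  have "sat E (\<lambda>_. a) extensionality_ax"
    by (rule sat_ZF) (simp add: ZF_def)
  then have "\<forall>x y. (\<forall>z. z \<in> elts x \<longleftrightarrow> z \<in> elts y) \<longrightarrow> x = y"
    by (simp add: extensionality_ax_def numeral_eq_Suc)
  then show "elts a = elts b \<Longrightarrow> a = b" by auto
qed simp

definition coded :: "'a set \<Rightarrow> bool"
  where "coded A \<longleftrightarrow> (\<exists>a. elts a = A)"

text \<open>Using \<open>desc\<close> keeps this definable; on a set that is not coded the value is
  a fixed junk element.\<close>

definition mks :: "'a set \<Rightarrow> 'a"
  where "mks A = desc (\<lambda>a. elts a = A)"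

lemma mks_elts [simp]: "mks (elts a) = a"
  unfolding mks_def by (rule desc_eq) (simp_all add: elts_inject)

lemma elts_mks [simp]: "coded A \<Longrightarrow> elts (mks A) = A"
  unfolding coded_def by auto

lemma coded_elts [simp]: "coded (elts a)"
  by (auto simp: coded_def)

lemma dterm_mks [definable]:
  assumes "dpred (\<lambda>e. e 0 \<in> A (\<lambda>n. e (Suc n)))"
  shows "dterm (\<lambda>e. mks (A e))"
  unfolding mks_def
proof (intro definable)
  show "dpred (\<lambda>e. e 0 \<in> A (\<lambda>n. e (Suc (Suc n))))"
    using dpred_subst[OF assms, of "case_nat 0 (\<lambda>n. Suc (Suc n))"] by simp
qed

definition dset :: "'a set \<Rightarrow> bool"
  where "dset A \<longleftrightarrow> dpred (\<lambda>e. e 0 \<in> A)"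

text \<open>This is the Separation schema, freed from formulas: \<open>dset\<close> supplies the
  formula and its parameters, and \<open>a\<close> is the bounding set.\<close>

lemma coded_subset:
  assumes "A \<subseteq> elts a" "dset A"
  shows "coded A"
proof -
  obtain p s where p: "\<And>e. e 0 \<in> A \<longleftrightarrow> sat E (val s e) p"
    using assms(2) unfolding dset_def dpred_def by blast
  \<comment> \<open>Only entry 0 matters for membership in \<open>A\<close>, so a constant
    environment will do: all environment variables become index 0, and the parameters are placed
    after the indices of \<open>x\<close> and \<open>a\<close>.\<close>
  define r where "r n = (case s n of Inl c \<Rightarrow> Suc (Suc n) | Inr k \<Rightarrow> 0)" for n
  define c where "c n = (case s n of Inl c \<Rightarrow> c | Inr k \<Rightarrow> undefined)" for n
  have eq: "val s (\<lambda>_. x) = (\<lambda>n. case_nat x (case_nat a c) (r n))" for x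
    by (auto simp: val_def r_def c_def split: sum.split)
  then have A: "x \<in> A \<longleftrightarrow> sat E (case_nat x (case_nat a c)) (rename r p)" for x
    using p[of "\<lambda>_. x"] by (simp add: sat_rename)
  have "sat E e (Exists (Forall (0 \<^bold>\<in> 1 \<^bold>\<longleftrightarrow> (0 \<^bold>\<in> 2 \<^bold>\<and> rename (case_nat 0 (\<lambda>n. n + 2)) q))))" for e q
    by (rule sat_univ_closure, fold separation_ax_def, rule sat_ZF) (simp add: ZF_def)
  moreover have "sat E (case_nat x (case_nat b e)) (rename (case_nat 0 (\<lambda>n. n + 2)) q) =
      sat E (case_nat x e) q" for x b e q
  proof -
    have "(\<lambda>n. case_nat x (case_nat b e) (case_nat 0 (\<lambda>n. n + 2) n)) = case_nat x e"
      by (auto split: nat.split)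
    then show ?thesis by (simp only: sat_rename)
  qed
  ultimately have "\<exists>b. \<forall>x. x \<in> elts b \<longleftrightarrow> x \<in> elts (e 0) \<and> sat E (case_nat x e) q" for e q
    by (simp add: numeral_eq_Suc)
  from this[of "case_nat a c" "rename r p"]
  obtain b where b: "\<And>x. x \<in> elts b \<longleftrightarrow> x \<in> elts a \<and> x \<in> A"
    unfolding A by auto
  with b assms(1) have "elts b = A" by auto
  then show ?thesis by (auto simp: coded_def)
qed

text \<open>This takes the place of well-founded induction: only definable nonempty subsets of a set
  are known to have a minimal element.\<close>

lemma foundation:
  assumes "A \<subseteq> elts a" "dset A" "A \<noteq> {}"
  shows "\<exists>m\<in>A. elts m \<inter> A = {}"
proof -
  obtain b where b: "elts b = A"
    using coded_subset[OF assms(1,2)] by (auto simp: coded_def)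
  have "sat E (\<lambda>_. b) foundation_ax"
    by (rule sat_ZF) (simp add: ZF_def)
  then have "\<forall>x. elts x \<noteq> {} \<longrightarrow> (\<exists>y\<in>elts x. \<not> (\<exists>z\<in>elts y. z \<in> elts x))"
    by (simp add: foundation_ax_def is_empty_def numeral_eq_Suc)
  with b assms(3) show ?thesis by blast
qed

lemma coded_pair [simp]: "coded {x, y}"
proof -
  have "sat E (\<lambda>_. x) pairing_ax"
    by (rule sat_ZF) (simp add: ZF_def)
  then have "\<exists>a. \<forall>z. z \<in> elts a \<longleftrightarrow> (z = x \<or> z = y)"
    by (simp add: pairing_ax_def numeral_eq_Suc)
  then show ?thesis by (auto simp: coded_def set_eq_iff)
qed

lemma coded_singleton [simp]: "coded {x}"
  using coded_pair[of x x] by simp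

lemma coded_Union [simp]: "coded (\<Union>x\<in>elts a. elts x)"
proof -
  have "sat E (\<lambda>_. a) union_ax"
    by (rule sat_ZF) (simp add: ZF_def)
  then have "\<exists>b. \<forall>z. z \<in> elts b \<longleftrightarrow> (\<exists>x\<in>elts a. z \<in> elts x)"
    by (simp add: union_ax_def numeral_eq_Suc)
  then show ?thesis by (auto simp: coded_def set_eq_iff)
qed

lemma coded_Pow [simp]: "coded {x. elts x \<subseteq> elts a}"
proof -
  have "sat E (\<lambda>_. a) power_set_ax"
    by (rule sat_ZF) (simp add: ZF_def)
  then have "\<exists>b. \<forall>z. z \<in> elts b \<longleftrightarrow> (\<forall>x\<in>elts z. x \<in> elts a)"
    by (simp add: power_set_ax_def is_subset_def numeral_eq_Suc)
  then show ?thesis by (simp add: coded_def set_eq_iff subset_eq)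
qed

lemma coded_Un [simp]:
  assumes "coded A" "coded B"
  shows "coded (A \<union> B)"
proof -
  obtain a b where "elts a = A" "elts b = B"
    using assms by (auto simp: coded_def)
  then have "A \<union> B = (\<Union>x\<in>elts (mks {a, b}). elts x)" by simp
  then show ?thesis by (simp only: coded_Union)
qed

lemma coded_insert [simp]: "coded A \<Longrightarrow> coded (insert x A)"
  using coded_Un[OF coded_singleton] by (metis insert_is_Un)

text \<open>Foundation is applied to the set of the members of the cycle. Cycles of length three
  matter for ordinals: excluding them makes membership transitive among the elements of an
  ordinal.\<close>

lemma no_mem_cycle:
  "x \<notin> elts x"
  "x \<in> elts y \<Longrightarrow> y \<notin> elts x"
  "x \<in> elts y \<Longrightarrow> y \<in> elts z \<Longrightarrow> z \<notin> elts x"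
proof -
  have 3: "\<not> (x \<in> elts y \<and> y \<in> elts z \<and> z \<in> elts x)" for x y z
  proof
    assume *: "x \<in> elts y \<and> y \<in> elts z \<and> z \<in> elts x"
    have "dset {x, y, z}" unfolding dset_def by (intro definable)
    then obtain m where "m \<in> {x, y, z}" "elts m \<inter> {x, y, z} = {}"
      using foundation[of "{x, y, z}" "mks {x, y, z}"] by auto
    with * show False by auto
  qed
  then show "x \<notin> elts x" by blast
  have "\<not> (x \<in> elts y \<and> y \<in> elts x)"
  proof
    assume *: "x \<in> elts y \<and> y \<in> elts x"
    have "dset {x, y}" unfolding dset_def by (intro definable)
    then obtain m where "m \<in> {x, y}" "elts m \<inter> {x, y} = {}"
      using foundation[of "{x, y}" "mks {x, y}"] by auto
    with * show False by auto
  qed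
  then show "x \<in> elts y \<Longrightarrow> y \<notin> elts x" by blast
  from 3 show "x \<in> elts y \<Longrightarrow> y \<in> elts z \<Longrightarrow> z \<notin> elts x" by blast
qed

subsection \<open>Pairs and functions\<close>

definition pr :: "'a \<Rightarrow> 'a \<Rightarrow> 'a"
  where "pr x y = mks {mks {x}, mks {x, y}}"

lemma dterm_pr [definable]: "dterm t \<Longrightarrow> dterm u \<Longrightarrow> dterm (\<lambda>e. pr (t e) (u e))"
  by (rule dterm_comp2[where h = pr]) (unfold pr_def, intro definable)

lemma mks_pair_eq: "mks {x, y} = mks {u, v} \<longleftrightarrow> {x, y} = {u, v}"
  by (metis coded_pair elts_mks)

lemma pr_inject [simp]: "pr x y = pr u v \<longleftrightarrow> x = u \<and> y = v"
proof
  assume "pr x y = pr u v"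
  then have "{mks {x, x}, mks {x, y}} = {mks {u, u}, mks {u, v}}"
    unfolding pr_def by (simp only: mks_pair_eq insert_absorb2)
  then show "x = u \<and> y = v"
    by (auto simp: doubleton_eq_iff mks_pair_eq simp del: insert_absorb2)
qed simp

definition times :: "'a \<Rightarrow> 'a \<Rightarrow> 'a"
  where "times X Y = mks {pr x y |x y. x \<in> elts X \<and> y \<in> elts Y}"

lemma elts_times [simp]: "elts (times X Y) = {pr x y |x y. x \<in> elts X \<and> y \<in> elts Y}"
  unfolding times_def
proof (intro elts_mks coded_subset)
  \<comment> \<open>Kuratowski pairs over the union of both sets are elements of its double power
    set.\<close>
  define U where "U = mks (elts X \<union> elts Y)"
  define PU where "PU = mks {x. elts x \<subseteq> elts U}"
  have U: "elts U = elts X \<union> elts Y" by (simp add: U_def)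
  have PU: "elts PU = {x. elts x \<subseteq> elts U}" by (simp add: PU_def)
  have "elts (mks {x. elts x \<subseteq> elts PU}) = {x. elts x \<subseteq> elts PU}" by simp
  then show "{pr x y |x y. x \<in> elts X \<and> y \<in> elts Y} \<subseteq> elts (mks {x. elts x \<subseteq> elts PU})"
    by (auto simp: pr_def U PU)
  show "dset {pr x y |x y. x \<in> elts X \<and> y \<in> elts Y}"
    unfolding dset_def by (intro definable)
qed

definition rel :: "'a \<Rightarrow> 'a \<Rightarrow> 'a \<Rightarrow> bool"
  where "rel r x y \<longleftrightarrow> pr x y \<in> elts r"

lemma dpred_rel [definable]:
  "dterm r \<Longrightarrow> dterm t \<Longrightarrow> dterm u \<Longrightarrow> dpred (\<lambda>e. rel (r e) (t e) (u e))"
  unfolding rel_def by (intro definable)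

definition funct :: "'a \<Rightarrow> 'a \<Rightarrow> 'a \<Rightarrow> bool"
  where "funct f X Y \<longleftrightarrow> (\<forall>p\<in>elts f. \<exists>x\<in>elts X. \<exists>y\<in>elts Y. p = pr x y) \<and>
    (\<forall>x\<in>elts X. \<exists>y. rel f x y \<and> (\<forall>z. rel f x z \<longrightarrow> z = y))"

definition injn :: "'a \<Rightarrow> 'a \<Rightarrow> 'a \<Rightarrow> bool"
  where "injn f X Y \<longleftrightarrow> funct f X Y \<and> (\<forall>x x' y. rel f x y \<and> rel f x' y \<longrightarrow> x = x')"

definition bijn :: "'a \<Rightarrow> 'a \<Rightarrow> 'a \<Rightarrow> bool"
  where "bijn f X Y \<longleftrightarrow> injn f X Y \<and> (\<forall>y\<in>elts Y. \<exists>x\<in>elts X. rel f x y)"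

definition lepoll :: "'a \<Rightarrow> 'a \<Rightarrow> bool"
  where "lepoll X Y \<longleftrightarrow> (\<exists>f. injn f X Y)"

definition eqpoll :: "'a \<Rightarrow> 'a \<Rightarrow> bool"
  where "eqpoll X Y \<longleftrightarrow> (\<exists>f. bijn f X Y)"

lemma dpred_lepoll [definable]: "dterm t \<Longrightarrow> dterm u \<Longrightarrow> dpred (\<lambda>e. lepoll (t e) (u e))"
  by (rule dpred_comp2[where R = lepoll]) (unfold lepoll_def injn_def funct_def, intro definable)

lemma dpred_eqpoll [definable]: "dterm t \<Longrightarrow> dterm u \<Longrightarrow> dpred (\<lambda>e. eqpoll (t e) (u e))"
  by (rule dpred_comp2[where R = eqpoll]) (unfold eqpoll_def bijn_def injn_def funct_def, intro definable)

definition dfun :: "('a \<Rightarrow> 'a) \<Rightarrow> bool"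
  where "dfun h \<longleftrightarrow> dterm (\<lambda>e. h (e 0))"

lemma dterm_dfun: "dfun h \<Longrightarrow> dterm t \<Longrightarrow> dterm (\<lambda>e. h (t e))"
  unfolding dfun_def by (rule dterm_comp)

lemma dfun_comp: "dfun g \<Longrightarrow> dfun h \<Longrightarrow> dfun (\<lambda>x. g (h x))"
  by (unfold dfun_def) (rule dterm_comp)

text \<open>The prescribed target \<open>Y\<close> bounds the graph by \<open>times X Y\<close>, so
  Separation makes it a set.\<close>

lemma graph_exists:
  assumes "dfun h" "h ` elts X \<subseteq> elts Y"
  obtains f where "funct f X Y" "\<And>x y. rel f x y \<longleftrightarrow> x \<in> elts X \<and> y = h x"
proof -
  let ?G = "{pr x (h x) |x. x \<in> elts X}"
  have "coded ?G"
  proof (rule coded_subset)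
    show "?G \<subseteq> elts (times X Y)" using assms(2) by auto
    show "dset ?G" unfolding dset_def by (intro definable dterm_dfun[OF assms(1)])
  qed
  then have G: "elts (mks ?G) = ?G" by (rule elts_mks)
  then have rel: "rel (mks ?G) x y \<longleftrightarrow> x \<in> elts X \<and> y = h x" for x y
    by (auto simp: rel_def)
  have "funct (mks ?G) X Y"
    unfolding funct_def rel using assms(2) unfolding G by auto
  with rel show ?thesis using that by blast
qed

lemma funct_dfun:
  assumes "funct f X Y"
  obtains h where "dfun h" "h ` elts X \<subseteq> elts Y" "\<And>x y. rel f x y \<longleftrightarrow> x \<in> elts X \<and> y = h x"
proof
  define h where "h x = desc (rel f x)" for x
  show "dfun h" unfolding dfun_def h_def by (intro definable)
  have h: "rel f x (h x)" if "x \<in> elts X" for x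
    using assms that unfolding funct_def h_def by (metis desc_eq)
  show rel: "rel f x y \<longleftrightarrow> x \<in> elts X \<and> y = h x" for x y
    using assms h unfolding funct_def rel_def by (metis pr_inject)
  show "h ` elts X \<subseteq> elts Y"
    using assms h unfolding funct_def rel_def by (metis image_subsetI pr_inject)
qed

text \<open>This translation, with its analogue for \<open>eqpoll\<close>, allows cardinality
  arguments to be carried out with HOL functions, at the price of showing each of them
  definable.\<close>

lemma lepoll_iff:
  "lepoll X Y \<longleftrightarrow> (\<exists>h. dfun h \<and> inj_on h (elts X) \<and> h ` elts X \<subseteq> elts Y)"
proof
  assume "lepoll X Y"
  then obtain f where f: "funct f X Y" "\<And>x x' y. rel f x y \<Longrightarrow> rel f x' y \<Longrightarrow> x = x'"
    unfolding lepoll_def injn_def by blast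
  from f(1) show "\<exists>h. dfun h \<and> inj_on h (elts X) \<and> h ` elts X \<subseteq> elts Y"
    by (rule funct_dfun) (use f(2) in \<open>metis inj_onI\<close>)
next
  assume "\<exists>h. dfun h \<and> inj_on h (elts X) \<and> h ` elts X \<subseteq> elts Y"
  then obtain h where h: "dfun h" "inj_on h (elts X)" "h ` elts X \<subseteq> elts Y" by blast
  from h(1,3) show "lepoll X Y"
    by (rule graph_exists) (use h(2) in \<open>auto simp: lepoll_def injn_def inj_on_def\<close>)
qed

lemma eqpoll_iff: "eqpoll X Y \<longleftrightarrow> (\<exists>h. dfun h \<and> bij_betw h (elts X) (elts Y))"
proof
  assume "eqpoll X Y"
  then obtain f where f: "funct f X Y" "\<And>x x' y. rel f x y \<Longrightarrow> rel f x' y \<Longrightarrow> x = x'"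
    "\<And>y. y \<in> elts Y \<Longrightarrow> \<exists>x\<in>elts X. rel f x y"
    unfolding eqpoll_def bijn_def injn_def by blast
  from f(1) obtain h where "dfun h" "h ` elts X \<subseteq> elts Y"
      "\<And>x y. rel f x y \<longleftrightarrow> x \<in> elts X \<and> y = h x"
    using funct_dfun by blast
  with f(2,3) show "\<exists>h. dfun h \<and> bij_betw h (elts X) (elts Y)"
    unfolding bij_betw_def inj_on_def by (intro exI[of _ h]) (auto simp: image_iff)
next
  assume "\<exists>h. dfun h \<and> bij_betw h (elts X) (elts Y)"
  then obtain h where h: "dfun h" "bij_betw h (elts X) (elts Y)" by blast
  then have "h ` elts X \<subseteq> elts Y" by (auto simp: bij_betw_def)
  with h(1) obtain f where "funct f X Y" "\<And>x y. rel f x y \<longleftrightarrow> x \<in> elts X \<and> y = h x"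
    using graph_exists by blast
  with h(2) have "bijn f X Y"
    by (auto simp: bijn_def injn_def bij_betw_def inj_on_def)
  then show "eqpoll X Y" by (auto simp: eqpoll_def)
qed

lemma lepoll_trans: "lepoll X Y \<Longrightarrow> lepoll Y Z \<Longrightarrow> lepoll X Z"
  unfolding lepoll_iff
proof (elim exE conjE)
  fix g h
  assume "dfun g" "inj_on g (elts X)" "g ` elts X \<subseteq> elts Y"
    and "dfun h" "inj_on h (elts Y)" "h ` elts Y \<subseteq> elts Z"
  then show "\<exists>f. dfun f \<and> inj_on f (elts X) \<and> f ` elts X \<subseteq> elts Z"
    by (intro exI[of _ "\<lambda>x. h (g x)"]) (auto simp: dfun_comp inj_on_def image_subset_iff)
qed

lemma eqpoll_trans: "eqpoll X Y \<Longrightarrow> eqpoll Y Z \<Longrightarrow> eqpoll X Z"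
  unfolding eqpoll_iff
proof (elim exE conjE)
  fix g h
  assume "dfun g" "bij_betw g (elts X) (elts Y)" "dfun h" "bij_betw h (elts Y) (elts Z)"
  then show "\<exists>f. dfun f \<and> bij_betw f (elts X) (elts Z)"
    by (intro exI[of _ "\<lambda>x. h (g x)"]) (use bij_betw_trans in \<open>auto simp: dfun_comp comp_def\<close>)
qed

lemma lepoll_subset: "elts X \<subseteq> elts Y \<Longrightarrow> lepoll X Y"
  unfolding lepoll_iff by (intro exI[of _ "\<lambda>x. x"]) (auto simp: dfun_def intro: definable)

subsection \<open>Natural numbers and finite sets\<close>

definition emp :: 'a
  where "emp = mks {}"

definition suc :: "'a \<Rightarrow> 'a"
  where "suc n = mks (insert n (elts n))"

lemma elts_emp [simp]: "elts emp = {}"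
  unfolding emp_def by (intro elts_mks coded_subset[of _ undefined]) (auto simp: dset_def intro: definable)

lemma elts_suc [simp]: "elts (suc n) = insert n (elts n)"
  unfolding suc_def by simp

lemma dterm_suc [definable]: "dterm t \<Longrightarrow> dterm (\<lambda>e. suc (t e))"
  by (rule dterm_comp[where h = suc]) (unfold suc_def, intro definable)

definition indset :: "'a \<Rightarrow> bool"
  where "indset w \<longleftrightarrow> emp \<in> elts w \<and> (\<forall>n\<in>elts w. suc n \<in> elts w)"

lemma sat_is_empty: "sat E e (is_empty x) \<longleftrightarrow> e x = emp"
  using elts_inject[of "e x" emp] by (auto simp: is_empty_def)

lemma sat_is_succ: "sat E e (is_succ x y) \<longleftrightarrow> e y = suc (e x)"
  using elts_inject[of "e y" "suc (e x)"] by (auto simp: is_succ_def)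

lemma sat_is_inductive: "sat E e (is_inductive x) \<longleftrightarrow> indset (e x)"
  by (auto simp: is_inductive_def indset_def sat_is_empty sat_is_succ)

definition omega :: 'a
  where "omega = mks {x. \<forall>w. indset w \<longrightarrow> x \<in> elts w}"

lemma elts_omega: "elts omega = {x. \<forall>w. indset w \<longrightarrow> x \<in> elts w}"
proof -
  have "sat E (\<lambda>_. emp) infinity_ax"
    by (rule sat_ZF) (simp add: ZF_def)
  then obtain w where w: "indset w"
    by (auto simp: infinity_ax_def sat_is_inductive)
  show ?thesis unfolding omega_def
  proof (intro elts_mks coded_subset)
    show "{x. \<forall>w. indset w \<longrightarrow> x \<in> elts w} \<subseteq> elts w" using w by blast
    show "dset {x. \<forall>w. indset w \<longrightarrow> x \<in> elts w}"
      unfolding dset_def indset_def by (intro definable)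
  qed
qed

lemma indset_omega: "indset omega"
  unfolding indset_def elts_omega by blast

lemma emp_omega [simp]: "emp \<in> elts omega"
  and suc_omega [simp]: "n \<in> elts omega \<Longrightarrow> suc n \<in> elts omega"
  using indset_omega by (auto simp: indset_def)

lemma sat_is_omega: "sat E e (is_omega x) \<longleftrightarrow> e x = omega"
proof -
  have "sat E e (is_omega x) \<longleftrightarrow> indset (e x) \<and> (\<forall>w. indset w \<longrightarrow> elts (e x) \<subseteq> elts w)"
    by (auto simp: is_omega_def is_subset_def sat_is_inductive)
  also have "\<dots> \<longleftrightarrow> elts (e x) = elts omega"
  proof
    assume "elts (e x) = elts omega"
    then have "e x = omega" by (simp only: elts_inject)
    then show "indset (e x) \<and> (\<forall>w. indset w \<longrightarrow> elts (e x) \<subseteq> elts w)"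
      using indset_omega by (auto simp: elts_omega)
  next
    assume "indset (e x) \<and> (\<forall>w. indset w \<longrightarrow> elts (e x) \<subseteq> elts w)"
    then show "elts (e x) = elts omega"
      using indset_omega unfolding elts_omega by blast
  qed
  finally show ?thesis by (simp add: elts_inject)
qed

text \<open>Restricted to definable \<open>P\<close>: the elements satisfying \<open>P\<close> must
  form a set of the model before leastness of \<open>omega\<close> applies.\<close>

lemma omega_induct [consumes 2, case_names emp suc]:
  assumes P: "dpred (\<lambda>e. P (e 0))" and n: "n \<in> elts omega"
    and "P emp" and "\<And>n. n \<in> elts omega \<Longrightarrow> P n \<Longrightarrow> P (suc n)"
  shows "P n"
proof -
  have "dset {n \<in> elts omega. P n}"
    unfolding dset_def by (intro definable P)
  then have "coded {n \<in> elts omega. P n}"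
    by (rule coded_subset[rotated]) auto
  then have w: "elts (mks {n \<in> elts omega. P n}) = {n \<in> elts omega. P n}"
    by (rule elts_mks)
  have "indset (mks {n \<in> elts omega. P n})"
    unfolding indset_def w using assms(3,4) by auto
  then have "n \<in> elts (mks {n \<in> elts omega. P n})"
    using n unfolding elts_omega by blast
  then show ?thesis unfolding w by simp
qed

definition fin :: "'a \<Rightarrow> bool"
  where "fin X \<longleftrightarrow> (\<exists>n\<in>elts omega. eqpoll X n)"

definition cnt :: "'a \<Rightarrow> bool"
  where "cnt X \<longleftrightarrow> lepoll X omega"

lemma fin_lepoll_omega:
  assumes "n \<in> elts omega" "lepoll X n"
  shows "fin X"
proof -
  \<comment> \<open>The quantifier over \<open>X\<close> belongs to the induction predicate because
    the step passes from \<open>X\<close> to \<open>X\<close> without one element.\<close>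
  have "dpred (\<lambda>e. \<forall>X. lepoll X (e 0) \<longrightarrow> fin X)"
    unfolding fin_def by (intro definable)
  from this assms(1) have "\<forall>X. lepoll X n \<longrightarrow> fin X"
  proof (induction n rule: omega_induct)
    case emp
    have "eqpoll X emp" if "lepoll X emp" for X
      using that unfolding lepoll_iff eqpoll_iff by (auto simp: bij_betw_def)
    then show ?case unfolding fin_def using emp_omega by blast
  next
    case (suc n)
    show ?case
    proof (intro allI impI)
      fix X assume "lepoll X (suc n)"
      then obtain h where h: "dfun h" "inj_on h (elts X)" "h ` elts X \<subseteq> insert n (elts n)"
        unfolding lepoll_iff by auto
      show "fin X"
      proof (cases "n \<in> h ` elts X")
        case False
        with h have "lepoll X n" unfolding lepoll_iff by blast
        with suc show ?thesis by blast
      next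
        case True
        then obtain x where x: "x \<in> elts X" "h x = n" by blast
        define X' where "X' = mks (elts X - {x})"
        have "coded (elts X - {x})"
          by (rule coded_subset[of _ X]) (blast, unfold dset_def, intro definable)
        then have X': "elts X' = elts X - {x}" unfolding X'_def by (rule elts_mks)
        have "lepoll X' n"
          unfolding lepoll_iff X' using h x
          by (intro exI[of _ h]) (auto simp: inj_on_def image_subset_iff)
        with suc obtain m g where m: "m \<in> elts omega" and g: "dfun g" "bij_betw g (elts X') (elts m)"
          unfolding fin_def eqpoll_iff by blast
        \<comment> \<open>The removed element \<open>x\<close> receives the new top value
          \<open>m\<close>, which differs from all values of \<open>g\<close> because
          \<open>m\<close> is not a member of itself.\<close>
        have "bij_betw (\<lambda>y. if y = x then m else g y) (elts X) (elts (suc m))"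
        proof -
          have "elts X = insert x (elts X')" using x X' by auto
          then show ?thesis
            using g(2) X' no_mem_cycle(1)[of m] by (auto simp: bij_betw_def inj_on_def)
        qed
        moreover have "dfun (\<lambda>y. if y = x then m else g y)"
          unfolding dfun_def by (intro definable dterm_dfun[OF g(1)])
        ultimately show ?thesis
          using m unfolding fin_def eqpoll_iff by (intro bexI[of _ "suc m"]) auto
      qed
    qed
  qed
  with assms(2) show ?thesis by blast
qed

lemma eqpoll_imp_lepoll: "eqpoll X Y \<Longrightarrow> lepoll X Y"
  unfolding eqpoll_def lepoll_def bijn_def by blast

lemma fin_lepoll: "fin Y \<Longrightarrow> lepoll X Y \<Longrightarrow> fin X"
  unfolding fin_def[of Y] using fin_lepoll_omega lepoll_trans eqpoll_imp_lepoll by blast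

lemma cnt_lepoll: "cnt Y \<Longrightarrow> lepoll X Y \<Longrightarrow> cnt X"
  unfolding cnt_def using lepoll_trans by blast

subsection \<open>Ordinals\<close>

definition ord :: "'a \<Rightarrow> bool"
  where "ord w \<longleftrightarrow> (\<forall>x\<in>elts w. elts x \<subseteq> elts w) \<and>
    (\<forall>x\<in>elts w. \<forall>y\<in>elts w. x \<in> elts y \<or> x = y \<or> y \<in> elts x)"

lemma ord_trans: "ord w \<Longrightarrow> x \<in> elts w \<Longrightarrow> y \<in> elts x \<Longrightarrow> y \<in> elts w"
  unfolding ord_def by blast

lemma ord_linear:
  "ord w \<Longrightarrow> x \<in> elts w \<Longrightarrow> y \<in> elts w \<Longrightarrow> x \<in> elts y \<or> x = y \<or> y \<in> elts x"
  unfolding ord_def by blast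

lemma ord_elem_trans:
  assumes "ord w" "z \<in> elts w" "y \<in> elts z" "x \<in> elts y"
  shows "x \<in> elts z"
  using assms ord_linear[of w x z] ord_trans no_mem_cycle by metis

text \<open>If \<open>D\<close> is not everything, then a minimal element of its complement has
  exactly the members of \<open>D\<close> as its elements, by linearity and downward
  closure.\<close>

lemma ord_initial_segment:
  assumes w: "ord w" and D: "D \<subseteq> elts w" "dset D" "\<And>d. d \<in> D \<Longrightarrow> elts d \<subseteq> D"
  shows "D = elts w \<or> (\<exists>d\<in>elts w. D = elts d)"
proof (rule ccontr)
  assume *: "\<not> ?thesis"
  have "dset (elts w - D)"
    unfolding dset_def by (intro definable D(2)[unfolded dset_def])
  then obtain m where m: "m \<in> elts w - D" "elts m \<inter> (elts w - D) = {}"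
    using foundation[of "elts w - D" w] * D(1) by blast
  have "elts m \<subseteq> D" using m ord_trans[OF w, of m] by blast
  moreover have "D \<subseteq> elts m"
    using m D(1,3) ord_linear[OF w, of m] by blast
  ultimately show False using * m by blast
qed

lemma ord_omega: "ord omega"
proof -
  have "dpred (\<lambda>e. elts (e 0) \<subseteq> elts omega)" by (intro definable)
  then have sub: "elts n \<subseteq> elts omega" if "n \<in> elts omega" for n
    using that by (induction n rule: omega_induct) auto
  have "dpred (\<lambda>e. ord (e 0))" unfolding ord_def by (intro definable)
  then have ord: "ord n" if "n \<in> elts omega" for n
    using that by (induction n rule: omega_induct) (auto simp: ord_def)
  have "m \<in> elts n \<or> m = n \<or> n \<in> elts m" if "m \<in> elts omega" "n \<in> elts omega" for m n
  proof -
    \<comment> \<open>The intersection is an initial segment of both ordinals. Were it proper in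
      both, the same element \<open>d\<close> would represent it in each, and \<open>d\<close> would
      lie in the intersection and so in itself.\<close>
    let ?D = "elts m \<inter> elts n"
    have d: "dset ?D" unfolding dset_def by (intro definable)
    have trans: "elts d \<subseteq> ?D" if "d \<in> ?D" for d
      using that ord[OF \<open>m \<in> _\<close>] ord[OF \<open>n \<in> _\<close>] ord_trans by blast
    have "?D = elts m \<or> (\<exists>d\<in>elts m. ?D = elts d)" "?D = elts n \<or> (\<exists>d\<in>elts n. ?D = elts d)"
      using ord_initial_segment[OF ord _ d trans] that by auto
    then show ?thesis
      by (metis IntI elts_inject no_mem_cycle(1))
  qed
  with sub show ?thesis unfolding ord_def by blast
qed

section \<open>The first uncountable ordinal and the Mostowski collapse\<close>

definition aleph1 :: "'a \<Rightarrow> bool"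
  where "aleph1 w \<longleftrightarrow> ord w \<and> \<not> cnt w \<and> (\<forall>x\<in>elts w. cnt x)"

text \<open>
  The Mostowski collapse of a set \<open>S\<close> of ordinals, as the union of the relations that satisfy its
  recursion equation on an initial segment of \<open>S\<close>.
\<close>

definition partial_collapse :: "'a \<Rightarrow> 'a \<Rightarrow> bool"
  where "partial_collapse S g \<longleftrightarrow> (\<forall>u x. rel g u x \<longrightarrow> u \<in> elts S \<and>
    elts x = {y. \<exists>v\<in>elts u \<inter> elts S. rel g v y} \<and> (\<forall>v\<in>elts u \<inter> elts S. \<exists>y. rel g v y))"

text \<open>Restricting the values to \<open>W\<close> keeps the graph inside the product of
  \<open>S\<close> and \<open>W\<close>, where Separation applies, and the range inside an
  ordinal.\<close>

definition collapse :: "'a \<Rightarrow> 'a \<Rightarrow> 'a \<Rightarrow> 'a \<Rightarrow> bool"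
  where "collapse S W u x \<longleftrightarrow> x \<in> elts W \<and> (\<exists>g. partial_collapse S g \<and> rel g u x)"

lemma dpred_collapse [definable]:
  "dterm t \<Longrightarrow> dterm u \<Longrightarrow> dpred (\<lambda>e. collapse S W (t e) (u e))"
  by (rule dpred_comp2[where R = "collapse S W"])
    (unfold collapse_def partial_collapse_def, intro definable)

text \<open>At a minimal disagreement both relations are defined and equal at all smaller elements
  of \<open>S\<close>, so by the recursion equation the two values have the same elements.\<close>

lemma partial_collapse_unique:
  assumes "partial_collapse S g" "partial_collapse S g'" "rel g u x" "rel g' u x'"
  shows "x = x'"
proof (rule ccontr)
  assume "x \<noteq> x'"
  let ?A = "{u \<in> elts S. \<exists>x x'. rel g u x \<and> rel g' u x' \<and> x \<noteq> x'}"
  have "dset ?A" unfolding dset_def by (intro definable)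
  moreover have "u \<in> ?A" using assms \<open>x \<noteq> x'\<close> unfolding partial_collapse_def by blast
  ultimately obtain m where m: "m \<in> ?A" "elts m \<inter> ?A = {}"
    using foundation[of ?A S] by blast
  then obtain y y' where y: "rel g m y" "rel g' m y'" "y \<noteq> y'" by blast
  have g: "elts y = {z. \<exists>v\<in>elts m \<inter> elts S. rel g v z}" "\<forall>v\<in>elts m \<inter> elts S. \<exists>z. rel g v z"
    using assms(1) y(1) unfolding partial_collapse_def by blast+
  have g': "elts y' = {z. \<exists>v\<in>elts m \<inter> elts S. rel g' v z}" "\<forall>v\<in>elts m \<inter> elts S. \<exists>z. rel g' v z"
    using assms(2) y(2) unfolding partial_collapse_def by blast+
  have "rel g v z \<longleftrightarrow> rel g' v z" if "v \<in> elts m \<inter> elts S" for v z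
    using m(2) that g(2) g'(2) by blast
  then have "elts y = elts y'" unfolding g(1) g'(1) by blast
  with y(3) show False by (simp add: elts_inject)
qed

text \<open>The collapse is injective and its range is an initial segment of \<open>W\<close>; a
  proper one is a countable element of \<open>W\<close>. So uncountability of \<open>W\<close>
  excludes that the values run out before \<open>S\<close> is exhausted, and uncountability of
  \<open>S\<close> excludes a proper segment as the range.\<close>

lemma uncountable_subset_eqpoll_aleph1:
  assumes W: "aleph1 W" and S: "elts S \<subseteq> elts W" "\<not> cnt S"
  shows "eqpoll S W"
proof -
  have ordW: "ord W" and uncW: "\<not> cnt W" and cntW: "\<And>x. x \<in> elts W \<Longrightarrow> cnt x"
    using W by (auto simp: aleph1_def)
  let ?C = "collapse S W"
  have dom: "u \<in> elts S" "x \<in> elts W" if "?C u x" for u x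
    using that unfolding collapse_def partial_collapse_def by blast+
  have unique: "x = x'" if "?C u x" "?C u x'" for u x x'
    using that partial_collapse_unique unfolding collapse_def by blast
  have rec: "elts x = {y. \<exists>v\<in>elts u \<inter> elts S. ?C v y}"
    and below: "\<And>v. v \<in> elts u \<inter> elts S \<Longrightarrow> \<exists>y. ?C v y" if u: "?C u x" for u x
  proof -
    obtain g where g: "partial_collapse S g" "rel g u x" "x \<in> elts W"
      using u unfolding collapse_def by blast
    then have x: "elts x = {y. \<exists>v\<in>elts u \<inter> elts S. rel g v y}"
      and ex: "\<forall>v\<in>elts u \<inter> elts S. \<exists>y. rel g v y"
      unfolding partial_collapse_def by blast+
    \<comment> \<open>The recursion equation of \<open>g\<close> passes to the union of all partial
      collapses because they agree with \<open>g\<close> below \<open>u\<close>, and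
      \<open>W\<close> is transitive.\<close>
    have C: "?C v y \<longleftrightarrow> rel g v y" if v: "v \<in> elts u \<inter> elts S" for v y
    proof
      assume "rel g v y"
      then have "y \<in> elts W" using x v ord_trans[OF ordW g(3)] by blast
      with g(1) \<open>rel g v y\<close> show "?C v y" unfolding collapse_def by blast
    next
      assume "?C v y"
      then obtain g' where g': "partial_collapse S g'" "rel g' v y"
        unfolding collapse_def by blast
      obtain y' where y': "rel g v y'" using ex v by blast
      with partial_collapse_unique[OF g'(1) g(1) g'(2)] show "rel g v y" by simp
    qed
    show "elts x = {y. \<exists>v\<in>elts u \<inter> elts S. ?C v y}" using x C by blast
    show "\<And>v. v \<in> elts u \<inter> elts S \<Longrightarrow> \<exists>y. ?C v y" using ex C by blast
  qed
  \<comment> \<open>If one argument were a member of the other, the recursion equation would make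
    \<open>x\<close> a member of itself.\<close>
  have inj: "u = v" if "?C u x" "?C v x" for u v x
    using ord_linear[OF ordW, of u v] that dom S(1) rec no_mem_cycle(1)[of x] by blast
  \<comment> \<open>Used for the elements of \<open>S\<close> below a given one, and for
    \<open>S\<close> itself.\<close>
  have image: "{y. \<exists>v\<in>A. ?C v y} = elts W \<or> (\<exists>d\<in>elts W. {y. \<exists>v\<in>A. ?C v y} = elts d)"
    if A: "dset A" "\<And>u v. u \<in> A \<Longrightarrow> v \<in> elts u \<Longrightarrow> v \<in> elts S \<Longrightarrow> v \<in> A" for A
  proof (rule ord_initial_segment[OF ordW])
    show "{y. \<exists>v\<in>A. ?C v y} \<subseteq> elts W" using dom by blast
    show "dset {y. \<exists>v\<in>A. ?C v y}"
      unfolding dset_def by (intro definable A(1)[unfolded dset_def])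
    show "elts d \<subseteq> {y. \<exists>v\<in>A. ?C v y}" if "d \<in> {y. \<exists>v\<in>A. ?C v y}" for d
      using that rec A(2) by blast
  qed
  have total: "\<exists>x. ?C u x" if u: "u \<in> elts S" for u
  proof (rule ccontr)
    assume no: "\<not> (\<exists>x. ?C u x)"
    let ?N = "{u \<in> elts S. \<not> (\<exists>x. ?C u x)}"
    have "dset ?N" unfolding dset_def by (intro definable)
    then obtain s where s: "s \<in> elts S" "\<not> (\<exists>x. ?C s x)" "elts s \<inter> ?N = {}"
      using foundation[of ?N S] u no by blast
    let ?A = "elts s \<inter> elts S"
    have sW: "s \<in> elts W" using s(1) S(1) by blast
    have "dset ?A" unfolding dset_def by (intro definable)
    then have "{y. \<exists>v\<in>?A. ?C v y} = elts W \<or> (\<exists>d\<in>elts W. {y. \<exists>v\<in>?A. ?C v y} = elts d)"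
      by (rule image) (use ord_elem_trans[OF ordW sW] in blast)
    then show False
    proof (elim disjE bexE)
      \<comment> \<open>The values below \<open>s\<close> already fill \<open>W\<close>. Sending
        each value back to its argument injects \<open>W\<close> into the countable
        \<open>s\<close>.\<close>
      assume img: "{y. \<exists>v\<in>?A. ?C v y} = elts W"
      let ?h = "\<lambda>y. desc (\<lambda>v. ?C v y)"
      have h: "?C (?h y) y" "?h y \<in> ?A" if y: "y \<in> elts W" for y
      proof -
        obtain v where v: "v \<in> ?A" "?C v y" using img y by blast
        then have "?h y = v" using inj by (intro desc_eq) blast+
        with v show "?C (?h y) y" "?h y \<in> ?A" by auto
      qed
      have "dfun ?h" unfolding dfun_def by (intro definable)
      moreover have "inj_on ?h (elts W)"
      proof (rule inj_onI)
        fix y z assume yz: "y \<in> elts W" "z \<in> elts W" "?h y = ?h z"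
        from h(1)[OF yz(1)] h(1)[OF yz(2)] show "y = z" unfolding yz(3) by (rule unique)
      qed
      moreover have "?h ` elts W \<subseteq> elts s" using h(2) by blast
      ultimately have "lepoll W s" unfolding lepoll_iff by blast
      with cntW[OF sW] uncW show False using cnt_lepoll by blast
    next
      \<comment> \<open>The recursion prescribes the value \<open>d\<close> at \<open>s\<close>.
        Adding this pair yields a partial collapse defined at \<open>s\<close>, against the choice
        of \<open>s\<close>.\<close>
      fix d assume d: "d \<in> elts W" "{y. \<exists>v\<in>?A. ?C v y} = elts d"
      let ?G = "{pr v y |v y. ?C v y \<or> v = s \<and> y = d}"
      have "coded ?G"
      proof (rule coded_subset)
        show "?G \<subseteq> elts (times S W)" using dom s(1) d(1) by auto
        show "dset ?G" unfolding dset_def by (intro definable)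
      qed
      then have G: "rel (mks ?G) v y \<longleftrightarrow> ?C v y \<or> v = s \<and> y = d" for v y
        by (auto simp: rel_def)
      have "partial_collapse S (mks ?G)"
        unfolding partial_collapse_def G
      proof (intro allI impI)
        fix v y assume "?C v y \<or> v = s \<and> y = d"
        then show "v \<in> elts S \<and>
          elts y = {z. \<exists>t\<in>elts v \<inter> elts S. ?C t z \<or> t = s \<and> z = d} \<and>
          (\<forall>t\<in>elts v \<inter> elts S. \<exists>z. ?C t z \<or> t = s \<and> z = d)"
        proof
          assume v: "?C v y"
          \<comment> \<open>The new pair does not disturb the old recursion equations: the domain
            contains with \<open>v\<close> all smaller elements of \<open>S\<close>, so
            \<open>s\<close> cannot be one of them.\<close>
          then have "s \<notin> elts v" using below s(1,2) by blast
          with rec[OF v] below[OF v] dom[OF v] show ?thesis by blast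
        next
          assume "v = s \<and> y = d"
          moreover have "\<forall>t\<in>?A. \<exists>z. ?C t z" using s(3) by blast
          ultimately show ?thesis using d(2) s(1) no_mem_cycle(1)[of s] by blast
        qed
      qed
      moreover have "rel (mks ?G) s d" using G by simp
      ultimately have "?C s d" using d(1) collapse_def[of S W s d] by blast
      with s(2) show False by blast
    qed
  qed
  let ?h = "\<lambda>u. desc (?C u)"
  have h: "?C u (?h u)" if u: "u \<in> elts S" for u
  proof -
    obtain x where "?C u x" using total[OF u] by blast
    then have "?h u = x" using unique by (intro desc_eq) blast+
    with \<open>?C u x\<close> show ?thesis by simp
  qed
  have dfun: "dfun ?h" unfolding dfun_def by (intro definable)
  have inj_h: "inj_on ?h (elts S)"
  proof (rule inj_onI)
    fix u v assume uv: "u \<in> elts S" "v \<in> elts S" "?h u = ?h v"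
    from h[OF uv(1)] h[OF uv(2)] show "u = v" unfolding uv(3) by (rule inj)
  qed
  have img: "?h ` elts S = {y. \<exists>v\<in>elts S. ?C v y}" using h unique by blast
  have "dset (elts S)" unfolding dset_def by (intro definable)
  then have "?h ` elts S = elts W \<or> (\<exists>d\<in>elts W. ?h ` elts S = elts d)"
    unfolding img by (rule image) blast
  then show ?thesis
  proof (elim disjE bexE)
    assume "?h ` elts S = elts W"
    with dfun inj_h show ?thesis unfolding eqpoll_iff bij_betw_def by blast
  next
    fix d assume d: "d \<in> elts W" "?h ` elts S = elts d"
    with dfun inj_h have "lepoll S d" unfolding lepoll_iff by blast
    with cntW[OF d(1)] S(2) show ?thesis using cnt_lepoll by blast
  qed
qed


section \<open>The partial order on a disjoint union of finite sets\<close>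

definition porder :: "'a \<Rightarrow> 'a \<Rightarrow> bool"
  where "porder X r \<longleftrightarrow> (\<forall>p\<in>elts r. \<exists>x\<in>elts X. \<exists>y\<in>elts X. p = pr x y) \<and>
    (\<forall>x\<in>elts X. rel r x x) \<and>
    (\<forall>x\<in>elts X. \<forall>y\<in>elts X. rel r x y \<and> rel r y x \<longrightarrow> x = y) \<and>
    (\<forall>x\<in>elts X. \<forall>y\<in>elts X. \<forall>z\<in>elts X. rel r x y \<and> rel r y z \<longrightarrow> rel r x z)"

definition chain :: "'a \<Rightarrow> 'a \<Rightarrow> 'a \<Rightarrow> bool"
  where "chain C X r \<longleftrightarrow> elts C \<subseteq> elts X \<and>
    (\<forall>x\<in>elts C. \<forall>y\<in>elts C. rel r x y \<or> rel r y x)"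

definition antichain :: "'a \<Rightarrow> 'a \<Rightarrow> 'a \<Rightarrow> bool"
  where "antichain C X r \<longleftrightarrow> elts C \<subseteq> elts X \<and>
    (\<forall>x\<in>elts C. \<forall>y\<in>elts C. x \<noteq> y \<longrightarrow> \<not> (rel r x y \<or> rel r y x))"

definition choice :: "'a \<Rightarrow> 'a \<Rightarrow> bool"
  where "choice f B \<longleftrightarrow> (\<exists>Y. funct f B Y) \<and> (\<forall>b\<in>elts B. \<forall>y. rel f b y \<longrightarrow> y \<in> elts b)"

text \<open>
  The elements of the pieces \<open>{a} \<times> a\<close> are ordered by the indices \<open>F a\<close> of their pieces.  Antichains
  lie in one piece, and chains meet each piece at most once.
\<close>

lemma partial_choice:
  assumes CAC: "\<And>X r. porder X r \<Longrightarrow> (\<And>C. antichain C X r \<Longrightarrow> fin C) \<Longrightarrow>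
      (\<And>C. chain C X r \<Longrightarrow> cnt C) \<Longrightarrow> cnt X"
    and W: "aleph1 W" and A: "eqpoll A W"
    and fin: "\<And>a. a \<in> elts A \<Longrightarrow> fin a" and nonempty: "\<And>a. a \<in> elts A \<Longrightarrow> elts a \<noteq> {}"
  shows "\<exists>B f. elts B \<subseteq> elts A \<and> eqpoll B W \<and> choice f B"
proof -
  have ordW: "ord W" using W by (simp add: aleph1_def)
  obtain F where F: "dfun F" "bij_betw F (elts A) (elts W)"
    using A unfolding eqpoll_iff by blast
  note F_inj = bij_betw_imp_inj_on[OF F(2), THEN inj_onD]
  have FW: "F a \<in> elts W" if "a \<in> elts A" for a
    using F(2) that by (auto simp: bij_betw_def)
  define U where "U = mks (\<Union>a\<in>elts A. elts a)"
  have U: "elts U = (\<Union>a\<in>elts A. elts a)" by (simp add: U_def)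
  \<comment> \<open>Tagging each element by its member separates the copies of an element common to
    several members.\<close>
  define X where "X = mks {pr a x |a x. a \<in> elts A \<and> x \<in> elts a}"
  have X: "elts X = {pr a x |a x. a \<in> elts A \<and> x \<in> elts a}"
    unfolding X_def
  proof (intro elts_mks coded_subset)
    show "{pr a x |a x. a \<in> elts A \<and> x \<in> elts a} \<subseteq> elts (times A U)"
      by (auto simp: U)
    show "dset {pr a x |a x. a \<in> elts A \<and> x \<in> elts a}"
      unfolding dset_def by (intro definable)
  qed
  let ?R = "{pr (pr a x) (pr b y) |a x b y. pr a x \<in> elts X \<and> pr b y \<in> elts X \<and>
      (a = b \<and> x = y \<or> F a \<in> elts (F b))}"
  have "coded ?R"
  proof (rule coded_subset)
    show "?R \<subseteq> elts (times X X)" by auto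
    show "dset ?R" unfolding dset_def by (intro definable dterm_dfun[OF F(1)])
  qed
  then obtain r where r: "elts r = ?R" unfolding coded_def by blast
  have rel: "rel r (pr a x) (pr b y) \<longleftrightarrow> pr a x \<in> elts X \<and> pr b y \<in> elts X \<and>
      (a = b \<and> x = y \<or> F a \<in> elts (F b))" for a x b y
    unfolding rel_def r by auto
  have XE: "\<exists>a x. p = pr a x \<and> a \<in> elts A \<and> x \<in> elts a" if "p \<in> elts X" for p
    using that unfolding X by blast
  \<comment> \<open>Distinct members have distinct indices under \<open>F\<close>, and any two
    indices are comparable in \<open>W\<close>.\<close>
  have linear: "a = b" if "pr a x \<in> elts X" "pr b y \<in> elts X"
      "\<not> rel r (pr a x) (pr b y)" "\<not> rel r (pr b y) (pr a x)" for a x b y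
  proof -
    have "a \<in> elts A" "b \<in> elts A" using that(1,2) X by auto
    then show ?thesis
      using ord_linear[OF ordW FW FW, of a b] F_inj that rel by blast
  qed
  have porder: "porder X r"
    unfolding porder_def
  proof (intro conjI ballI impI)
    fix p assume p: "p \<in> elts X"
    then obtain a x where px: "p = pr a x" using XE by blast
    show "rel r p p" using p by (simp add: px rel)
    fix q assume q: "q \<in> elts X"
    then obtain b y where qy: "q = pr b y" using XE by blast
    show "p = q" if "rel r p q \<and> rel r q p"
      using that no_mem_cycle(2)[of "F a" "F b"] by (auto simp: px qy rel)
    fix s assume s: "s \<in> elts X"
    then obtain c z where sz: "s = pr c z" "c \<in> elts A" using XE by blast
    show "rel r p s" if "rel r p q \<and> rel r q s"
      using that ord_elem_trans[OF ordW FW[OF sz(2)], of "F b" "F a"] by (auto simp: px qy sz rel)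
  next
    fix p assume "p \<in> elts r"
    then show "\<exists>x\<in>elts X. \<exists>y\<in>elts X. p = pr x y" unfolding r by blast
  qed
  have antichain: "fin C" if C: "antichain C X r" for C
  proof (cases "elts C = {}")
    case True
    then show ?thesis
      using emp_omega by (intro fin_lepoll_omega[of emp] lepoll_subset) simp_all
  next
    case False
    then obtain p where p: "p \<in> elts C" by blast
    with C XE obtain a x where px: "p = pr a x" "a \<in> elts A"
      unfolding antichain_def by blast
    have same: "\<exists>y. q = pr a y \<and> y \<in> elts a" if q: "q \<in> elts C" for q
    proof -
      obtain b y where qy: "q = pr b y" "y \<in> elts b"
        using C XE q unfolding antichain_def by blast
      have "a = b"
      proof (cases "p = q")
        case False
        then show ?thesis
          using C p q linear[of a x b y] unfolding antichain_def px qy by blast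
      qed (simp add: px qy)
      with qy show ?thesis by blast
    qed
    let ?h = "\<lambda>q. desc (\<lambda>y. q = pr a y)"
    have h: "?h (pr a y) = y" for y by (rule desc_eq) simp_all
    have "dfun ?h" unfolding dfun_def by (intro definable)
    moreover have "inj_on ?h (elts C)"
      using same h by (intro inj_onI) metis
    moreover have "?h ` elts C \<subseteq> elts a" using same h by fastforce
    ultimately have "lepoll C a" unfolding lepoll_iff by blast
    with fin[OF px(2)] show ?thesis by (rule fin_lepoll)
  qed
  show ?thesis
  proof (cases "\<forall>C. chain C X r \<longrightarrow> cnt C")
    case False
    then obtain C where C: "elts C \<subseteq> elts X" "\<not> cnt C"
        "\<And>p q. p \<in> elts C \<Longrightarrow> q \<in> elts C \<Longrightarrow> rel r p q \<or> rel r q p"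
      unfolding chain_def by blast
    have CE: "\<exists>a x. p = pr a x \<and> a \<in> elts A \<and> x \<in> elts a" if "p \<in> elts C" for p
      using that C(1) XE by blast
    \<comment> \<open>Comparable elements of one piece coincide because \<open>F a\<close> is not a
      member of itself.\<close>
    have same: "x = y" if "pr a x \<in> elts C" "pr a y \<in> elts C" for a x y
      using C(3)[OF that] no_mem_cycle(1)[of "F a"] by (auto simp: rel)
    let ?B = "{a \<in> elts A. \<exists>x. pr a x \<in> elts C}"
    have "coded ?B"
      by (rule coded_subset[of _ A]) (blast, unfold dset_def, intro definable)
    then obtain B where B: "elts B = ?B" unfolding coded_def by blast
    let ?S = "{w \<in> elts W. \<exists>a\<in>elts B. w = F a}"
    have "coded ?S"
      by (rule coded_subset[of _ W]) (blast, unfold dset_def, intro definable dterm_dfun[OF F(1)])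
    then obtain S where "elts S = ?S" unfolding coded_def by blast
    then have S: "elts S = F ` elts B" using B FW by auto
    \<comment> \<open>Forgetting the second component loses nothing on \<open>C\<close>, which
      contains at most one pair for each \<open>a\<close>; so \<open>S\<close> inherits the
      uncountability of \<open>C\<close>.\<close>
    let ?h = "\<lambda>p. desc (\<lambda>w. \<exists>a x. p = pr a x \<and> w = F a)"
    have h: "?h (pr a x) = F a" for a x by (rule desc_eq) auto
    have "lepoll C S"
      unfolding lepoll_iff
    proof (intro exI conjI)
      show "dfun ?h" unfolding dfun_def by (intro definable dterm_dfun[OF F(1)])
      show "inj_on ?h (elts C)"
      proof (rule inj_onI)
        fix p q assume pq: "p \<in> elts C" "q \<in> elts C" "?h p = ?h q"
        obtain a x b y where *: "p = pr a x" "a \<in> elts A" "q = pr b y" "b \<in> elts A"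
          using CE pq(1,2) by meson
        with pq(3) have "a = b" by (simp only: h) (rule F_inj)
        with same pq(1,2) * show "p = q" by simp
      qed
      show "?h ` elts C \<subseteq> elts S"
      proof
        fix w assume "w \<in> ?h ` elts C"
        then obtain p where p: "p \<in> elts C" "w = ?h p" by blast
        then obtain a x where px: "p = pr a x" "a \<in> elts A" using CE by blast
        then have "w = F a" using p(2) by (simp only: h)
        with p(1) px show "w \<in> elts S" unfolding S B by blast
      qed
    qed
    with C(2) have "\<not> cnt S" using cnt_lepoll by blast
    moreover have "elts S \<subseteq> elts W" using S B FW by auto
    ultimately have "eqpoll S W" using uncountable_subset_eqpoll_aleph1[OF W] by blast
    moreover have "eqpoll B S"
      unfolding eqpoll_iff bij_betw_def
      using F(1) S F_inj B by (intro exI[of _ F]) (auto simp: inj_on_def)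
    ultimately have "eqpoll B W" using eqpoll_trans by blast
    \<comment> \<open>The tagged elements are pairs, so the chain itself is the graph of the choice
      function.\<close>
    moreover have "choice C B"
      unfolding choice_def
    proof (intro conjI exI)
      show "funct C B U"
        unfolding funct_def
      proof (intro conjI ballI)
        fix p assume p: "p \<in> elts C"
        then obtain a x where "p = pr a x" "a \<in> elts A" "x \<in> elts a" using CE by blast
        with p show "\<exists>a\<in>elts B. \<exists>x\<in>elts U. p = pr a x" unfolding B U by blast
      next
        fix a assume "a \<in> elts B"
        then obtain x where "pr a x \<in> elts C" unfolding B by blast
        then show "\<exists>x. rel C a x \<and> (\<forall>y. rel C a y \<longrightarrow> y = x)"
          unfolding rel_def using same by blast
      qed
      show "\<forall>b\<in>elts B. \<forall>y. rel C b y \<longrightarrow> y \<in> elts b"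
        unfolding rel_def using CE by fastforce
    qed
    moreover have "elts B \<subseteq> elts A" using B by blast
    ultimately show ?thesis by blast
  next
    case True
    then have "cnt X" using CAC[OF porder antichain] by blast
    then obtain i where i: "dfun i" "inj_on i (elts X)" "i ` elts X \<subseteq> elts omega"
      unfolding cnt_def lepoll_iff by blast
    \<comment> \<open>Membership is the order of \<open>omega\<close>, so this describes the element
      of \<open>a\<close> with the least code under \<open>i\<close>; injectivity of
      \<open>i\<close> makes it unique, as \<open>desc\<close> demands.\<close>
    let ?least = "\<lambda>a x. x \<in> elts a \<and> (\<forall>y\<in>elts a. i (pr a y) \<notin> elts (i (pr a x)))"
    let ?h = "\<lambda>a. desc (?least a)"
    have h: "?h a \<in> elts a" if a: "a \<in> elts A" for a
    proof -
      have aX: "pr a x \<in> elts X" if "x \<in> elts a" for x using a that X by blast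
      let ?I = "{n \<in> elts omega. \<exists>x\<in>elts a. n = i (pr a x)}"
      have "dset ?I" unfolding dset_def by (intro definable dterm_dfun[OF i(1)])
      moreover obtain x where "x \<in> elts a" using nonempty[OF a] by blast
      then have "i (pr a x) \<in> ?I" using i(3) aX by blast
      ultimately obtain m where m: "m \<in> ?I" "elts m \<inter> ?I = {}"
        using foundation[of ?I omega] by blast
      then obtain z where z: "z \<in> elts a" "m = i (pr a z)" by blast
      have "i (pr a y) \<notin> elts (i (pr a z))" if y: "y \<in> elts a" for y
        using m(2) z(2) aX[OF y] i(3) y by blast
      with z(1) have least: "?least a z" by blast
      have "?h a = z"
      proof (rule desc_eq)
        fix y assume y: "?least a y"
        then have "i (pr a y) = i (pr a z)"
          using ord_linear[OF ord_omega, of "i (pr a y)" "i (pr a z)"] least i(3) aX by blast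
        then show "y = z" using inj_onD[OF i(2)] y least aX by fastforce
      qed (rule least)
      with z(1) show ?thesis by simp
    qed
    have "dfun ?h" unfolding dfun_def by (intro definable dterm_dfun[OF i(1)])
    moreover have "?h ` elts A \<subseteq> elts U" using h unfolding U by blast
    ultimately obtain f where f: "funct f A U" "\<And>a x. rel f a x \<longleftrightarrow> a \<in> elts A \<and> x = ?h a"
      using graph_exists by blast
    have "choice f A"
      unfolding choice_def
    proof (intro conjI exI ballI allI impI)
      show "funct f A U" by (rule f(1))
      fix a x assume "a \<in> elts A" "rel f a x"
      then show "x \<in> elts a" unfolding f(2) using h by simp
    qed
    \<comment> \<open>Here the whole family serves as the subfamily.\<close>
    with A show ?thesis by blast
  qed
qed

subsection \<open>Satisfaction of the defined notions\<close>

lemma sat_is_subset: "sat E e (is_subset x y) \<longleftrightarrow> elts (e x) \<subseteq> elts (e y)"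
  by (auto simp: is_subset_def)

lemma sat_is_upair: "sat E e (is_upair x y z) \<longleftrightarrow> e z = mks {e x, e y}"
proof -
  have "sat E e (is_upair x y z) \<longleftrightarrow> elts (e z) = elts (mks {e x, e y})"
    by (auto simp: is_upair_def)
  then show ?thesis by (simp only: elts_inject)
qed

lemma sat_is_pair: "sat E e (is_pair x y z) \<longleftrightarrow> e z = pr (e x) (e y)"
  by (auto simp: is_pair_def sat_is_upair pr_def numeral_eq_Suc)

lemma sat_related: "sat E e (related r x y) \<longleftrightarrow> rel (e r) (e x) (e y)"
  by (auto simp: related_def sat_is_pair rel_def)

lemma sat_is_relation: "sat E e (is_relation r x y) \<longleftrightarrow>
    (\<forall>p\<in>elts (e r). \<exists>a\<in>elts (e x). \<exists>b\<in>elts (e y). p = pr a b)"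
  by (simp add: is_relation_def sat_is_pair numeral_eq_Suc)

lemma sat_is_function: "sat E e (is_function f x y) \<longleftrightarrow> funct (e f) (e x) (e y)"
  by (simp add: is_function_def funct_def sat_is_relation sat_related numeral_eq_Suc)

lemma sat_is_injection: "sat E e (is_injection f x y) \<longleftrightarrow> injn (e f) (e x) (e y)"
  by (simp add: is_injection_def injn_def sat_is_function sat_related numeral_eq_Suc)

lemma sat_is_bijection: "sat E e (is_bijection f x y) \<longleftrightarrow> bijn (e f) (e x) (e y)"
  by (simp add: is_bijection_def bijn_def sat_is_injection sat_related numeral_eq_Suc)

lemma sat_is_finite: "sat E e (is_finite x) \<longleftrightarrow> fin (e x)"
  by (simp add: is_finite_def fin_def eqpoll_def sat_is_omega sat_is_bijection numeral_eq_Suc)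

lemma sat_is_countable: "sat E e (is_countable x) \<longleftrightarrow> cnt (e x)"
  by (simp add: is_countable_def cnt_def lepoll_def sat_is_omega sat_is_injection numeral_eq_Suc)

lemma sat_is_ordinal: "sat E e (is_ordinal x) \<longleftrightarrow> ord (e x)"
  by (simp add: is_ordinal_def ord_def sat_is_subset numeral_eq_Suc)

lemma sat_is_aleph1: "sat E e (is_aleph1 x) \<longleftrightarrow> aleph1 (e x)"
  by (simp add: is_aleph1_def aleph1_def sat_is_ordinal sat_is_countable)

lemma sat_has_size_aleph1:
  "sat E e (has_size_aleph1 x) \<longleftrightarrow> (\<exists>w. aleph1 w \<and> eqpoll (e x) w)"
  by (simp add: has_size_aleph1_def eqpoll_def sat_is_aleph1 sat_is_bijection numeral_eq_Suc)

lemma sat_is_partial_order: "sat E e (is_partial_order x r) \<longleftrightarrow> porder (e x) (e r)"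
  by (simp add: is_partial_order_def porder_def sat_is_relation sat_related numeral_eq_Suc)

lemma sat_is_chain: "sat E e (is_chain c x r) \<longleftrightarrow> chain (e c) (e x) (e r)"
  by (simp add: is_chain_def chain_def sat_is_subset sat_related numeral_eq_Suc)

lemma sat_is_antichain: "sat E e (is_antichain c x r) \<longleftrightarrow> antichain (e c) (e x) (e r)"
  by (simp add: is_antichain_def antichain_def sat_is_subset sat_related numeral_eq_Suc)

lemma sat_is_choice_function: "sat E e (is_choice_function f x) \<longleftrightarrow> choice (e f) (e x)"
  by (simp add: is_choice_function_def choice_def sat_is_function sat_related numeral_eq_Suc)

theorem sat_CAC_imp_PAC: "sat E e (CAC_1_aleph0 \<^bold>\<longrightarrow> PAC_fin_aleph1)"
proof -
  have "sat E e PAC_fin_aleph1" if "sat E e CAC_1_aleph0"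
  proof -
    have "\<forall>X r. porder X r \<and> (\<forall>C. antichain C X r \<longrightarrow> fin C) \<and> (\<forall>C. chain C X r \<longrightarrow> cnt C)
        \<longrightarrow> cnt X"
      using that
      by (simp add: CAC_1_aleph0_def sat_is_partial_order sat_is_antichain sat_is_chain
          sat_is_finite sat_is_countable numeral_eq_Suc)
    then have CAC: "cnt X" if "porder X r" "\<And>C. antichain C X r \<Longrightarrow> fin C"
        "\<And>C. chain C X r \<Longrightarrow> cnt C" for X r
      using that by blast
    have "\<exists>B. elts B \<subseteq> elts A \<and> (\<exists>w. aleph1 w \<and> eqpoll B w) \<and> (\<exists>f. choice f B)"
      if "aleph1 W" "eqpoll A W" "\<forall>a\<in>elts A. a \<noteq> emp \<and> fin a" for A W
    proof -
      have "\<exists>B f. elts B \<subseteq> elts A \<and> eqpoll B W \<and> choice f B"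
      proof (rule partial_choice)
        show "cnt X" if "porder X r" "\<And>C. antichain C X r \<Longrightarrow> fin C"
          "\<And>C. chain C X r \<Longrightarrow> cnt C" for X r
          using that by (rule CAC)
        show "fin a" "elts a \<noteq> {}" if "a \<in> elts A" for a
          using \<open>\<forall>a\<in>elts A. a \<noteq> emp \<and> fin a\<close> that elts_inject[of a emp] by auto
      qed (rule that)+
      with that(1) show ?thesis by blast
    qed
    then show ?thesis
      by (auto simp: PAC_fin_aleph1_def sat_has_size_aleph1 sat_is_empty sat_is_finite
          sat_is_subset sat_is_choice_function)
  qed
  then show ?thesis by simp
qed

end


section \<open>Derivability\<close>

text \<open>
  The domain of the term model has to be a type, so the theory to be refuted is fixed here.  Provable
  equality is an equivalence relation whether or not this theory is consistent.
\<close>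

definition counter_theory :: "fm set"
  where "counter_theory = henkin (insert (\<^bold>\<not> (CAC_1_aleph0 \<^bold>\<longrightarrow> PAC_fin_aleph1)) ZF)"

quotient_type term_class = nat / "\<lambda>x y. counter_theory \<turnstile> (x \<^bold>= y)"
  by (rule equivpI)
    (auto intro!: reflpI sympI transpI intro: derives.EqRefl derives_eq_sym derives_eq_trans)

definition class_mem :: "term_class \<Rightarrow> term_class \<Rightarrow> bool"
  where "class_mem a b \<longleftrightarrow> counter_theory \<turnstile> (rep_term_class a \<^bold>\<in> rep_term_class b)"

text \<open>Closedness is needed twice: it leaves fresh variables for the Henkin witnesses, and it
  carries truth of the axioms from one environment to all.\<close>

lemma arity_ZF: "p \<in> ZF \<Longrightarrow> arity p = 0"
  by (auto simp: ZF_def separation_ax_def replacement_ax_def arity_univ_closure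
      extensionality_ax_def foundation_ax_def pairing_ax_def union_ax_def power_set_ax_def
      infinity_ax_def is_inductive_def is_succ_def is_empty_def is_subset_def All_in_def Ex_in_def
      Exists_def Iff_fm_def And_fm_def Or_fm_def Not_fm_def)

lemma arity_CAC_imp_PAC: "arity (CAC_1_aleph0 \<^bold>\<longrightarrow> PAC_fin_aleph1) = 0"
  by (simp add: CAC_1_aleph0_def PAC_fin_aleph1_def is_partial_order_def is_antichain_def
      is_chain_def is_finite_def is_countable_def has_size_aleph1_def is_aleph1_def is_ordinal_def
      is_choice_function_def is_function_def is_injection_def is_bijection_def is_omega_def
      is_relation_def related_def is_pair_def is_upair_def is_inductive_def is_succ_def
      is_empty_def is_subset_def All_in_def Ex_in_def Exists_def Iff_fm_def And_fm_def Or_fm_def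
      Not_fm_def)

theorem theorem4p5: "ZF \<turnstile> (CAC_1_aleph0 \<^bold>\<longrightarrow> PAC_fin_aleph1)"
proof (rule derives.Contr, rule ccontr)
  let ?p = "CAC_1_aleph0 \<^bold>\<longrightarrow> PAC_fin_aleph1"
  let ?H = "insert (\<^bold>\<not> ?p) ZF"
  assume "\<not> ?H \<turnstile> Falsum"
  have "arity q = 0" if "q \<in> ?H" for q
    using that arity_ZF arity_CAC_imp_PAC by (auto simp: Not_fm_def)
  then have "\<not> henkin ?H \<turnstile> Falsum"
    using \<open>\<not> ?H \<turnstile> Falsum\<close> by (rule henkin_consistent)
  have "sat class_mem (\<lambda>n. abs_term_class (f n)) q \<longleftrightarrow> henkin ?H \<turnstile> rename f q" for f q
  proof (rule henkin_model)
    show "\<not> henkin ?H \<turnstile> Falsum" by fact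
    show "surj abs_term_class"
      using Quotient_term_class by (metis Quotient_abs_rep surjI)
    show eq: "abs_term_class x = abs_term_class y \<longleftrightarrow> henkin ?H \<turnstile> (x \<^bold>= y)" for x y
      by (simp add: term_class.abs_eq_iff counter_theory_def)
    \<comment> \<open>The representative of a class need not be the given variable but is provably
      equal to it, so membership between representatives transfers to the variables.\<close>
    have rep: "henkin ?H \<turnstile> (rep_term_class (abs_term_class x) \<^bold>= x)" for x
      unfolding eq[symmetric] using Quotient_term_class by (metis Quotient_abs_rep)
    show "class_mem (abs_term_class x) (abs_term_class y) \<longleftrightarrow> henkin ?H \<turnstile> (x \<^bold>\<in> y)" for x y
      unfolding class_mem_def counter_theory_def
      using rep derives_eq_sym derives_Member_cong by blast
  qed
  from this[of "\<lambda>n. n"] have model: "sat class_mem abs_term_class q" if "q \<in> ?H" for q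
    using that henkin_extends[of ?H] by (auto simp: rename_ident intro: derives.Assm)
  \<comment> \<open>The truth lemma yields the axioms in the canonical environment only; the locale
    demands every environment.\<close>
  interpret zf_model class_mem
  proof
    show "sat class_mem e q" if "q \<in> ZF" for q e
      using model[of q] sat_closed[OF arity_ZF[OF that]] that by blast
  qed
  have "sat class_mem abs_term_class (\<^bold>\<not> ?p)" by (rule model) simp
  then show False using sat_CAC_imp_PAC[of abs_term_class] unfolding sat_simps by blast
qed

end
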